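(* The action of Thompson's group $F$ on the set of dyadic rationals in $(0,1)$ is $2$-Liouville, and the action of the group $F_{\mathbb{R}}$ on the set of all dyadic rationals is $2$-Liouville.
   Context: $F_{\mathbb{R}}$ is the group of all piecewise linear homeomorphisms of $\mathbb{R}$ (with finitely many breakpoints, mapping the set $\mathbb{Z}[1/2]$ of dyadic rationals onto itself) whose slopes are powers of $2$ and whose breaking points of the first derivative are dyadic rationals. Thompson's group $F$ is the subgroup of $F_{\mathbb{R}}$ consisting of the homeomorphisms that are the identity outside $[0,1]$. For a countable discrete group $G$ acting on a set $Y$, a probability measure $\mu$ on $G$ is non-degenerate if its support generates $G$ as a semigroup. Put $p_\mu(x,y)=\sum_{g\in G,\ gx=y}\mu(g)$ for $x,y\in Y$. A function $f:Y\to\mathbb{R}$ is $\mu$-harmonic if $f(x)=\sum_{y\in Y}f(y)p_\mu(x,y)$ for all $x\in Y$. The action of $G$ on $Y$ is $\mu$-Liouville if all bounded $\mu$-harmonic functions on $Y$ are constant, and Liouville if it is $\mu$-Liouville for some non-degenerate probability measure $\mu$ on $G$. For a set $X$ let $\mathcal{P}_n(X)$ be the set of all subsets of $X$ of cardinality $n$. An action of $G$ on $X$ is $n$-Liouville if the induced action of $G$ on $\mathcal{P}_n(X)$, given by $g\cdot A=\{ga: a\in A\}$, is Liouville. *)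

theory Defs
  imports "HOL-Probability.Probability" "HOL-Algebra.Group_Action" "HOL-Library.Ramsey"
begin

section \<open>Liouville actions\<close>

inductive_set semigroup_generated :: "('g, 'm) monoid_scheme \<Rightarrow> 'g set \<Rightarrow> 'g set"
  for G :: "('g, 'm) monoid_scheme" and S :: "'g set" where
  incl: "s \<in> S \<Longrightarrow> s \<in> semigroup_generated G S"
| mult: "a \<in> semigroup_generated G S \<Longrightarrow> b \<in> semigroup_generated G S \<Longrightarrow>
    a \<otimes>\<^bsub>G\<^esub> b \<in> semigroup_generated G S"

definition nondegenerate :: "('g, 'm) monoid_scheme \<Rightarrow> 'g pmf \<Rightarrow> bool" where
  "nondegenerate G \<mu> \<longleftrightarrow>
     set_pmf \<mu> \<subseteq> carrier G \<and> semigroup_generated G (set_pmf \<mu>) = carrier G"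

definition transition ::
    "('g, 'm) monoid_scheme \<Rightarrow> ('g \<Rightarrow> 'y \<Rightarrow> 'y) \<Rightarrow> 'g pmf \<Rightarrow> 'y \<Rightarrow> 'y \<Rightarrow> real" where
  "transition G \<phi> \<mu> x y = (\<Sum>\<^sub>\<infinity>g\<in>{g \<in> carrier G. \<phi> g x = y}. pmf \<mu> g)"

text \<open>Using \<open>has_sum\<close> rather than \<open>infsum\<close> makes convergence of the averaging sum part of
  harmonicity; for bounded functions it converges automatically.\<close>

definition harmonic ::
    "('g, 'm) monoid_scheme \<Rightarrow> 'y set \<Rightarrow> ('g \<Rightarrow> 'y \<Rightarrow> 'y) \<Rightarrow> 'g pmf \<Rightarrow> ('y \<Rightarrow> real) \<Rightarrow> bool" where
  "harmonic G Y \<phi> \<mu> f \<longleftrightarrow>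
     (\<forall>x\<in>Y. ((\<lambda>y. f y * transition G \<phi> \<mu> x y) has_sum f x) Y)"

definition measure_liouville ::
    "('g, 'm) monoid_scheme \<Rightarrow> 'y set \<Rightarrow> ('g \<Rightarrow> 'y \<Rightarrow> 'y) \<Rightarrow> 'g pmf \<Rightarrow> bool" where
  "measure_liouville G Y \<phi> \<mu> \<longleftrightarrow>
     (\<forall>f. bounded (f ` Y) \<and> harmonic G Y \<phi> \<mu> f \<longrightarrow> f constant_on Y)"

definition liouville :: "('g, 'm) monoid_scheme \<Rightarrow> 'y set \<Rightarrow> ('g \<Rightarrow> 'y \<Rightarrow> 'y) \<Rightarrow> bool" where
  "liouville G Y \<phi> \<longleftrightarrow> (\<exists>\<mu>. nondegenerate G \<mu> \<and> measure_liouville G Y \<phi> \<mu>)"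

text \<open>The restriction to \<open>nsets X n\<close> (the \<open>n\<close>-element subsets of \<open>X\<close>) makes the induced maps
  extensional, as \<^locale>\<open>group_action\<close> requires; it has no other effect.\<close>

definition nsets_action :: "'x set \<Rightarrow> nat \<Rightarrow> ('g \<Rightarrow> 'x \<Rightarrow> 'x) \<Rightarrow> 'g \<Rightarrow> 'x set \<Rightarrow> 'x set" where
  "nsets_action X n \<phi> g = (\<lambda>A\<in>nsets X n. \<phi> g ` A)"

definition n_liouville ::
    "nat \<Rightarrow> ('g, 'm) monoid_scheme \<Rightarrow> 'x set \<Rightarrow> ('g \<Rightarrow> 'x \<Rightarrow> 'x) \<Rightarrow> bool" where
  "n_liouville n G X \<phi> \<longleftrightarrow> liouville G (nsets X n) (nsets_action X n \<phi>)"

lemma (in group_action) nsets_action: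
  "group_action G (nsets E n) (nsets_action E n \<phi>)"
proof -
  interpret gh: group_hom G "BijGroup E" \<phi> by (rule group_hom)
  have cl: "\<phi> g ` A \<in> nsets E n" if "g \<in> carrier G" "A \<in> nsets E n" for g A
  proof -
    from that have "A \<subseteq> E" "finite A" "card A = n" by (auto simp: nsets_def)
    moreover from this have "inj_on (\<phi> g) A" using inj_prop[OF that(1)] inj_on_subset by blast
    ultimately show ?thesis
      using surj_prop[OF that(1)] by (auto simp: nsets_def card_image)
  qed
  have comp: "\<phi> g ` \<phi> h ` A = \<phi> (g \<otimes> h) ` A"
    if "g \<in> carrier G" "h \<in> carrier G" "A \<in> nsets E n" for g h A
    unfolding image_image using that composition_rule
    by (intro image_cong) (auto simp: nsets_def)
  have one: "\<phi> \<one> ` A = A" if "A \<in> nsets E n" for A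
  proof -
    have "\<phi> \<one> ` A = (\<lambda>x. x) ` A"
      using that by (intro image_cong) (auto simp: nsets_def BijGroup_def)
    then show ?thesis by simp
  qed
  have bij: "nsets_action E n \<phi> g \<in> Bij (nsets E n)" if g: "g \<in> carrier G" for g
  proof -
    have ig: "inv g \<in> carrier G" by (rule gh.G.inv_closed[OF g])
    have "\<phi> (inv g) ` \<phi> g ` A = A" if "A \<in> nsets E n" for A
      unfolding comp[OF ig g that] gh.G.l_inv[OF g] by (rule one[OF that])
    moreover have "\<phi> g ` \<phi> (inv g) ` A = A" if "A \<in> nsets E n" for A
      unfolding comp[OF g ig that] gh.G.r_inv[OF g] by (rule one[OF that])
    ultimately have "bij_betw (\<lambda>A. \<phi> g ` A) (nsets E n) (nsets E n)"
      by (intro bij_betw_byWitness[where f' = "\<lambda>A. \<phi> (inv g) ` A"] ballI image_subsetI)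
        (assumption | rule cl[OF g] cl[OF ig])+
    then show ?thesis
      by (simp add: Bij_def nsets_action_def)
  qed
  have "nsets_action E n \<phi> \<in> hom G (BijGroup (nsets E n))"
    unfolding hom_def
  proof (intro CollectI conjI ballI)
    show "nsets_action E n \<phi> \<in> carrier G \<rightarrow> carrier (BijGroup (nsets E n))"
      using bij by (simp add: BijGroup_def)
    fix g h assume gh: "g \<in> carrier G" "h \<in> carrier G"
    have "nsets_action E n \<phi> g \<otimes>\<^bsub>BijGroup (nsets E n)\<^esub> nsets_action E n \<phi> h =
        compose (nsets E n) (nsets_action E n \<phi> g) (nsets_action E n \<phi> h)"
      using bij gh by (simp add: BijGroup_def)
    also have "\<dots> = nsets_action E n \<phi> (g \<otimes> h)"
      unfolding compose_def nsets_action_def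
      by (rule restrict_ext) (simp only: restrict_apply cl gh comp if_True)
    finally show "nsets_action E n \<phi> (g \<otimes> h) =
        nsets_action E n \<phi> g \<otimes>\<^bsub>BijGroup (nsets E n)\<^esub> nsets_action E n \<phi> h" ..
  qed
  then show ?thesis
    unfolding group_action_def group_hom_def group_hom_axioms_def
    using gh.G.is_group group_BijGroup by blast
qed

section \<open>Thompson's group and the group of dyadic piecewise linear homeomorphisms of the line\<close>

definition dyadic_rationals :: "real set" where
  "dyadic_rationals = {of_int a / 2 ^ n |a n. True}"

text \<open>\<open>B\<close> contains all breakpoints of \<open>f\<close>: on any interval avoiding \<open>B\<close>, the map \<open>f\<close> is affine
  with a slope that is an integer power of 2.\<close>

definition FR_maps :: "(real \<Rightarrow> real) set" where
  "FR_maps = {f. (\<exists>g. homeomorphism UNIV UNIV f g) \<and>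
     (\<exists>B. finite B \<and> B \<subseteq> dyadic_rationals \<and>
        (\<forall>I. is_interval I \<and> I \<inter> B = {} \<longrightarrow>
           (\<exists>(k::int) c. \<forall>x\<in>I. f x = 2 powi k * x + c))) \<and>
     f ` dyadic_rationals = dyadic_rationals}"

definition F_maps :: "(real \<Rightarrow> real) set" where
  "F_maps = {f \<in> FR_maps. \<forall>x. x \<notin> {0..1} \<longrightarrow> f x = x}"

text \<open>Since \<open>BijGroup UNIV\<close> is the group of all permutations of the line, the products
  below are compositions.\<close>

definition FR :: "(real \<Rightarrow> real) monoid" where
  "FR = (BijGroup UNIV)\<lparr>carrier := FR_maps\<rparr>"

definition F :: "(real \<Rightarrow> real) monoid" where
  "F = FR\<lparr>carrier := F_maps\<rparr>"

text \<open>The evaluation action of a group of functions on an invariant set \<open>X\<close>.\<close>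

definition eval_action :: "'a set \<Rightarrow> ('a \<Rightarrow> 'a) \<Rightarrow> 'a \<Rightarrow> 'a" where
  "eval_action X g = restrict g X"

lemma FR_mapsI:
  assumes "homeomorphism UNIV UNIV f g" "finite B" "B \<subseteq> dyadic_rationals"
    and "\<And>I. is_interval I \<Longrightarrow> I \<inter> B = {} \<Longrightarrow> \<exists>(k::int) c. \<forall>x\<in>I. f x = 2 powi k * x + c"
    and "f ` dyadic_rationals = dyadic_rationals"
  shows "f \<in> FR_maps"
  unfolding FR_maps_def using assms by (intro CollectI conjI exI[of _ g] exI[of _ B]) simp_all

lemma FR_mapsE:
  assumes "f \<in> FR_maps"
  obtains g B where "homeomorphism UNIV UNIV f g" "finite B" "B \<subseteq> dyadic_rationals"
    "\<And>I. is_interval I \<Longrightarrow> I \<inter> B = {} \<Longrightarrow> \<exists>(k::int) c. \<forall>x\<in>I. f x = 2 powi k * x + c"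
    "f ` dyadic_rationals = dyadic_rationals"
proof -
  obtain g B where "homeomorphism UNIV UNIV f g" "finite B" "B \<subseteq> dyadic_rationals"
    and *: "\<forall>I. is_interval I \<and> I \<inter> B = {} \<longrightarrow> (\<exists>(k::int) c. \<forall>x\<in>I. f x = 2 powi k * x + c)"
    and "f ` dyadic_rationals = dyadic_rationals"
    using assms unfolding FR_maps_def by (elim CollectE conjE exE) (rule that)
  then show thesis by (intro that[of g B] *[rule_format] conjI)
qed

lemma FR_maps_cont:
  assumes "f \<in> FR_maps"
  shows "continuous_on A f"
  by (rule FR_mapsE[OF assms]) (meson continuous_on_subset homeomorphism_cont1 subset_UNIV)

lemma FR_maps_bij:
  assumes "f \<in> FR_maps"
  shows "bij f"
proof -
  obtain g where "homeomorphism UNIV UNIV f g" using assms by (rule FR_mapsE)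
  then show ?thesis by (intro o_bij[of g f]) (simp_all add: homeomorphism_def fun_eq_iff)
qed

lemma FR_maps_dyadic: "f \<in> FR_maps \<Longrightarrow> f ` dyadic_rationals = dyadic_rationals"
  by (simp add: FR_maps_def)

lemma interval_image:
  fixes f :: "real \<Rightarrow> real"
  assumes "continuous_on I f" "is_interval I"
  shows "is_interval (f ` I)"
  using assms connected_continuous_image is_interval_connected_1 by blast

lemma id_FR_maps: "(\<lambda>x. x) \<in> FR_maps"
proof (rule FR_mapsI[where g = "\<lambda>x. x" and B = "{}"])
  show "homeomorphism (UNIV::real set) UNIV (\<lambda>x. x) (\<lambda>x. x)"
    by (simp add: homeomorphism_def)
  show "\<exists>(k::int) c. \<forall>x\<in>I. x = 2 powi k * x + c" for I :: "real set"
    by (rule exI[of _ 0], rule exI[of _ 0]) simp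
qed simp_all

lemma compose_FR_maps:
  assumes f: "f \<in> FR_maps" and g: "g \<in> FR_maps"
  shows "g \<circ> f \<in> FR_maps"
proof -
  obtain f' A where A: "homeomorphism UNIV UNIV f f'" "finite A" "A \<subseteq> dyadic_rationals"
    "\<And>I. is_interval I \<Longrightarrow> I \<inter> A = {} \<Longrightarrow> \<exists>(k::int) c. \<forall>x\<in>I. f x = 2 powi k * x + c"
    using f by (rule FR_mapsE) (rule that)
  obtain g' B where B: "homeomorphism UNIV UNIV g g'" "finite B" "B \<subseteq> dyadic_rationals"
    "\<And>I. is_interval I \<Longrightarrow> I \<inter> B = {} \<Longrightarrow> \<exists>(k::int) c. \<forall>x\<in>I. g x = 2 powi k * x + c"
    using g by (rule FR_mapsE) (rule that)
  note fd = FR_maps_dyadic[OF f] and gd = FR_maps_dyadic[OF g]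
  have inj: "inj f" using FR_maps_bij[OF f] by (rule bij_is_inj)
  show ?thesis
  proof (rule FR_mapsI)
    show "homeomorphism UNIV UNIV (g \<circ> f) (f' \<circ> g')"
      using A(1) B(1) by (rule homeomorphism_compose)
    show "finite (A \<union> f -` B)" using A(2) B(2) inj by (simp add: finite_vimageI)
    have "f -` B \<subseteq> dyadic_rationals"
    proof
      fix x assume "x \<in> f -` B"
      then have "f x \<in> f ` dyadic_rationals" using B(3) fd by blast
      then show "x \<in> dyadic_rationals" by (simp add: inj_image_mem_iff[OF inj])
    qed
    then show "A \<union> f -` B \<subseteq> dyadic_rationals" using A(3) by simp
    show "(g \<circ> f) ` dyadic_rationals = dyadic_rationals"
      by (simp only: image_comp[symmetric] fd gd)
    fix I :: "real set" assume I: "is_interval I" "I \<inter> (A \<union> f -` B) = {}"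
    then have "I \<inter> A = {}" "f ` I \<inter> B = {}" by blast+
    then obtain k l :: int and c d where
      kc: "\<forall>x\<in>I. f x = 2 powi k * x + c" and ld: "\<forall>x\<in>f ` I. g x = 2 powi l * x + d"
      using A(4)[OF I(1)] B(4)[OF interval_image[OF FR_maps_cont[OF f] I(1)]] by meson
    have "\<forall>x\<in>I. (g \<circ> f) x = 2 powi (l + k) * x + (2 powi l * c + d)"
    proof
      fix x assume x: "x \<in> I"
      then have "(g \<circ> f) x = 2 powi l * (2 powi k * x + c) + d"
        using kc ld by simp
      then show "(g \<circ> f) x = 2 powi (l + k) * x + (2 powi l * c + d)"
        by (simp add: power_int_add distrib_left mult.assoc)
    qed
    then show "\<exists>(k::int) c. \<forall>x\<in>I. (g \<circ> f) x = 2 powi k * x + c" by (intro exI)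
  qed
qed

lemma inv_FR_maps:
  assumes f: "f \<in> FR_maps"
  shows "inv_into UNIV f \<in> FR_maps"
proof -
  let ?h = "inv_into UNIV f"
  have bij: "bij f" by (rule FR_maps_bij[OF f])
  have hf: "?h (f x) = x" and fh: "f (?h x) = x" for x
    using bij by (simp_all add: bij_def surj_f_inv_f)
  obtain g A where A: "homeomorphism UNIV UNIV f g" "finite A" "A \<subseteq> dyadic_rationals"
    "\<And>I. is_interval I \<Longrightarrow> I \<inter> A = {} \<Longrightarrow> \<exists>(k::int) c. \<forall>x\<in>I. f x = 2 powi k * x + c"
    using f by (rule FR_mapsE) (rule that)
  have "?h x = g x" for x
    using homeomorphism_apply1[OF A(1), of "?h x"] by (simp add: fh)
  then have "?h = g" by (rule ext)
  then have hom: "homeomorphism UNIV UNIV ?h f" using A(1) by (simp add: homeomorphism_symD)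
  note fd = FR_maps_dyadic[OF f]
  show ?thesis
  proof (rule FR_mapsI[OF hom])
    show "finite (f ` A)" using A(2) by (rule finite_imageI)
    show "f ` A \<subseteq> dyadic_rationals" using A(3) fd by blast
    show "?h ` dyadic_rationals = dyadic_rationals"
      using image_inv_f_f[OF bij_is_inj[OF bij], of dyadic_rationals] by (simp only: fd)
    fix I :: "real set" assume I: "is_interval I" "I \<inter> f ` A = {}"
    have "continuous_on I ?h"
      by (rule continuous_on_subset[OF homeomorphism_cont1[OF hom] subset_UNIV])
    then have "is_interval (?h ` I)" using I(1) by (rule interval_image)
    moreover have "?h ` I \<inter> A = {}"
    proof (rule ccontr)
      assume "?h ` I \<inter> A \<noteq> {}"
      then obtain x where "x \<in> I" "?h x \<in> A" by blast
      then have "f (?h x) \<in> I \<inter> f ` A" by (simp add: fh) (metis fh imageI)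
      then show False using I(2) by simp
    qed
    ultimately obtain k :: int and c where kc: "\<forall>x\<in>?h ` I. f x = 2 powi k * x + c"
      using A(4) by meson
    have "\<forall>x\<in>I. ?h x = 2 powi (- k) * x + (- (2 powi (- k) * c))"
    proof
      fix x assume "x \<in> I"
      then have "f (?h x) = 2 powi k * ?h x + c" using kc by simp
      then have "x = 2 powi k * ?h x + c" by (simp only: fh)
      then have "2 powi (- k) * x = 2 powi (- k) * (2 powi k * ?h x + c)" by (rule arg_cong)
      also have "\<dots> = ?h x + 2 powi (- k) * c"
        by (simp add: power_int_minus distrib_left)
      finally show "?h x = 2 powi (- k) * x + (- (2 powi (- k) * c))" by simp
    qed
    then show "\<exists>(k::int) c. \<forall>x\<in>I. ?h x = 2 powi k * x + c" by (intro exI)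
  qed
qed

lemma BijGroup_UNIV_mult: "bij f \<Longrightarrow> bij g \<Longrightarrow> g \<otimes>\<^bsub>BijGroup UNIV\<^esub> f = g \<circ> f"
  by (auto simp: BijGroup_def Bij_def compose_def fun_eq_iff)

lemma BijGroup_UNIV_inv:
  assumes "bij f"
  shows "inv\<^bsub>BijGroup UNIV\<^esub> f = inv_into UNIV f"
proof -
  interpret group "BijGroup (UNIV :: 'a set)" by (rule group_BijGroup)
  have b: "bij (inv_into UNIV f)" using assms by (rule bij_imp_bij_inv)
  have "inv_into UNIV f \<otimes>\<^bsub>BijGroup UNIV\<^esub> f = \<one>\<^bsub>BijGroup UNIV\<^esub>"
    using assms b by (simp add: BijGroup_UNIV_mult) (auto simp: BijGroup_def bij_def fun_eq_iff)
  then show ?thesis using assms b by (intro inv_equality) (auto simp: BijGroup_def Bij_def)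
qed

lemma FR_subgroup: "subgroup FR_maps (BijGroup UNIV)"
proof
  show "FR_maps \<subseteq> carrier (BijGroup UNIV)"
    using FR_maps_bij by (auto simp: BijGroup_def Bij_def)
  show "\<one>\<^bsub>BijGroup UNIV\<^esub> \<in> FR_maps"
    using id_FR_maps by (simp add: BijGroup_def restrict_UNIV)
qed (auto simp: BijGroup_UNIV_mult BijGroup_UNIV_inv FR_maps_bij compose_FR_maps inv_FR_maps)

lemma F_subgroup: "subgroup F_maps (BijGroup UNIV)"
proof
  show "F_maps \<subseteq> carrier (BijGroup UNIV)"
    using FR_maps_bij by (auto simp: F_maps_def BijGroup_def Bij_def)
  show "\<one>\<^bsub>BijGroup UNIV\<^esub> \<in> F_maps"
    using id_FR_maps by (simp add: F_maps_def BijGroup_def restrict_UNIV)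
  show "x \<otimes>\<^bsub>BijGroup UNIV\<^esub> y \<in> F_maps" if "x \<in> F_maps" "y \<in> F_maps" for x y
    using that by (auto simp: F_maps_def BijGroup_UNIV_mult FR_maps_bij
        intro: compose_FR_maps)
  show "inv\<^bsub>BijGroup UNIV\<^esub> x \<in> F_maps" if "x \<in> F_maps" for x
  proof -
    have "inv_into UNIV x y = y" if "y \<notin> {0..1}" for y
      using that \<open>x \<in> F_maps\<close> by (auto simp: F_maps_def intro!: inv_f_eq dest!: FR_maps_bij bij_is_inj)
    then show ?thesis
      using that by (auto simp: F_maps_def BijGroup_UNIV_inv FR_maps_bij inv_FR_maps)
  qed
qed

lemma eval_group_action:
  assumes H: "subgroup H (BijGroup UNIV)" and inv: "\<And>g. g \<in> H \<Longrightarrow> g ` X = X"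
  shows "group_action ((BijGroup UNIV)\<lparr>carrier := H\<rparr>) X (eval_action X)"
proof -
  have "H \<subseteq> carrier (BijGroup UNIV)" using H by (rule subgroup.subset)
  then have bij: "bij g" if "g \<in> H" for g using that by (auto simp: BijGroup_def Bij_def)
  have Bij: "restrict g X \<in> Bij X" if "g \<in> H" for g
  proof -
    have "bij_betw g X X"
      using bij[OF that] inv[OF that] by (auto simp: bij_betw_def bij_def intro: inj_on_subset)
    then show ?thesis by (simp add: Bij_def)
  qed
  have "eval_action X \<in> hom ((BijGroup UNIV)\<lparr>carrier := H\<rparr>) (BijGroup X)"
    unfolding hom_def
  proof (intro CollectI conjI ballI)
    show "eval_action X \<in> carrier ((BijGroup UNIV)\<lparr>carrier := H\<rparr>) \<rightarrow> carrier (BijGroup X)"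
      using Bij by (simp add: eval_action_def BijGroup_def)
    fix g h assume "g \<in> carrier ((BijGroup UNIV)\<lparr>carrier := H\<rparr>)"
      "h \<in> carrier ((BijGroup UNIV)\<lparr>carrier := H\<rparr>)"
    then have gh: "g \<in> H" "h \<in> H" by auto
    have "\<And>x. x \<in> X \<Longrightarrow> h x \<in> X" using inv[OF gh(2)] by blast
    then show "eval_action X (g \<otimes>\<^bsub>(BijGroup UNIV)\<lparr>carrier := H\<rparr>\<^esub> h) =
        eval_action X g \<otimes>\<^bsub>BijGroup X\<^esub> eval_action X h"
      using gh bij Bij
      by (simp add: BijGroup_UNIV_mult eval_action_def)
         (auto simp: BijGroup_def compose_def fun_eq_iff)
  qed
  then show ?thesis
    unfolding group_action_def group_hom_def group_hom_axioms_def
    by (simp add: group_BijGroup group.subgroup_imp_group[OF group_BijGroup H])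
qed

lemma FR_group_action: "group_action FR dyadic_rationals (eval_action dyadic_rationals)"
  unfolding FR_def by (rule eval_group_action[OF FR_subgroup]) (simp add: FR_maps_def)

lemma F_group_action:
  "group_action F (dyadic_rationals \<inter> {0<..<1}) (eval_action (dyadic_rationals \<inter> {0<..<1}))"
proof -
  have "g ` (dyadic_rationals \<inter> {0<..<1}) = dyadic_rationals \<inter> {0<..<1}" if g: "g \<in> F_maps" for g
  proof -
    have gR: "g \<in> FR_maps" and out: "\<And>x. x \<notin> {0..1} \<Longrightarrow> g x = x"
      using g by (auto simp: F_maps_def)
    have cont: "continuous_on UNIV g" using gR by (auto simp: FR_maps_def homeomorphism_def)
    have g01: "g 0 = 0" "g 1 = 1"
    proof -
      have "isCont g 0" "isCont g 1" using cont by (auto simp: continuous_on_eq_continuous_at)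
      then have l: "(g \<longlongrightarrow> g 0) (at_left 0)" and r: "(g \<longlongrightarrow> g 1) (at_right 1)"
        by (auto simp: isCont_def intro: filterlim_mono at_le)
      have l': "(g \<longlongrightarrow> 0) (at_left 0)"
        by (rule Lim_transform_eventually[OF tendsto_ident_at])
           (auto simp: eventually_at_filter out)
      have r': "(g \<longlongrightarrow> 1) (at_right 1)"
        by (rule Lim_transform_eventually[OF tendsto_ident_at])
           (auto simp: eventually_at_filter out)
      show "g 0 = 0" using tendsto_unique[OF _ l l'] by simp
      show "g 1 = 1" using tendsto_unique[OF _ r r'] by simp
    qed
    have inj: "inj g" and surj: "surj g" using FR_maps_bij[OF gR] by (auto simp: bij_def)
    have fix_out: "g x = x" if "x \<notin> {0<..<1}" for x
      using that g01 out[of x] by (cases "x = 0 \<or> x = 1") auto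
    have iff: "g x \<in> {0<..<1} \<longleftrightarrow> x \<in> {0<..<1}" for x
      using fix_out[of x] fix_out[of "g x"] inj by (metis injD)
    have gd: "g ` dyadic_rationals = dyadic_rationals" using gR by (simp add: FR_maps_def)
    show ?thesis
    proof (intro equalityI subsetI)
      fix y assume "y \<in> g ` (dyadic_rationals \<inter> {0<..<1})"
      then show "y \<in> dyadic_rationals \<inter> {0<..<1}" using gd iff by blast
    next
      fix y assume y: "y \<in> dyadic_rationals \<inter> {0<..<1}"
      then obtain x where "x \<in> dyadic_rationals" "y = g x" using gd by blast
      then show "y \<in> g ` (dyadic_rationals \<inter> {0<..<1})" using y iff by blast
    qed
  qed
  then have "group_action ((BijGroup UNIV)\<lparr>carrier := F_maps\<rparr>) (dyadic_rationals \<inter> {0<..<1})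
      (eval_action (dyadic_rationals \<inter> {0<..<1}))"
    by (rule eval_group_action[OF F_subgroup])
  then show ?thesis by (simp add: F_def FR_def)
qed

end

theory Submission
  imports Defs
begin

text \<open>
  The proof rests on two facts. First, an action of a countable group on a countable set is
  Liouville as soon as for every finite set of points there are finitely supported measures on the
  group which move all these points to almost the same distribution. A suitable \<open>\<mu>\<close> is a
  geometrically weighted mixture of such measures \<open>\<nu> j\<close>, where \<open>\<nu> j\<close> almost equalizes every point that
  the earlier \<open>\<nu> i\<close> can reach in a large number of steps. A long \<open>\<mu>\<close>-random walk started at one of
  finitely many points very likely hits a late index before it leaves the controlled region, and at
  that moment it almost forgets where it started; hence a bounded harmonic function cannot tell two
  points apart (\<open>liouville_criterion\<close>).

  Second, elements of both groups preserve the order, and any finite increasing tuple of dyadic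
  points can be carried to any other one. Given finitely many points \<open>x\<^sub>0 < x\<^sub>1 < \<dots>\<close>, a random group
  element may therefore be prescribed by a random strictly increasing sequence
  \<open>Z 0 < Z 1 < \<dots>\<close> of naturals: it takes \<open>x\<^sub>i\<close> to the point with number \<open>Z i\<close> of a fixed increasing
  chain. The pairs \<open>{x\<^sub>i, x\<^sub>j}\<close> are almost equalized if all pairs \<open>(Z i, Z j)\<close> with \<open>i < j\<close> have almost
  the same distribution (\<open>almost_pair_spreadable\<close>).

  Such a sequence is a random walk whose steps have rapidly growing random scales. Its starting point is
  uniform on a huge interval and, given a random \<open>r\<close>, the increments are independent, the one with
  number \<open>l\<close> uniform on an interval of length \<open>M ^ (r + l)\<close> for a large \<open>M\<close>. The difference
  \<open>Z j - Z i\<close> is dominated by its last increment, so it is almost uniform on scale \<open>r + j\<close> and almost independent of \<open>Z i\<close>; as \<open>r\<close> itself is uniform on a long interval,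
  scale \<open>r + j\<close> is almost indistinguishable from scale \<open>r\<close>. All three approximations are instances of
  one estimate: a shift that is short relative to an interval hardly changes averages over it
  (\<open>uniform_shift\<close>).
\<close>

section \<open>Almost equalizing measures and the Liouville property\<close>

lemma integrable_pmf_bounded:
  fixes f :: "'a \<Rightarrow> real"
  assumes "\<And>x. \<bar>f x\<bar> \<le> B"
  shows "integrable (measure_pmf p) f"
  by (rule measure_pmf.integrable_const_bound[where B = B]) (simp_all add: assms)

lemma expectation_diff_le:
  fixes f g d :: "'a \<Rightarrow> real"
  assumes "\<And>x. \<bar>f x\<bar> \<le> B" "\<And>x. \<bar>g x\<bar> \<le> B" "\<And>x. \<bar>d x\<bar> \<le> C"
    and "\<And>x. x \<in> set_pmf p \<Longrightarrow> \<bar>f x - g x\<bar> \<le> d x"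
  shows "\<bar>measure_pmf.expectation p f - measure_pmf.expectation p g\<bar> \<le> measure_pmf.expectation p d"
proof -
  note int = integrable_pmf_bounded[of f B p, OF assms(1)] integrable_pmf_bounded[of g B p, OF assms(2)]
    integrable_pmf_bounded[of d C p, OF assms(3)]
  have "measure_pmf.expectation p f - measure_pmf.expectation p g =
      measure_pmf.expectation p (\<lambda>x. f x - g x)"
    using int by simp
  also have "\<bar>\<dots>\<bar> \<le> measure_pmf.expectation p (\<lambda>x. \<bar>f x - g x\<bar>)"
    by (rule integral_abs_bound)
  also have "\<dots> \<le> measure_pmf.expectation p d"
    using int assms(4) by (intro integral_mono_AE) (auto simp: AE_measure_pmf_iff)
  finally show ?thesis .
qed

lemma expectation_diff_le_const:
  fixes f g :: "'a \<Rightarrow> real"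
  assumes "\<And>x. \<bar>f x\<bar> \<le> B" "\<And>x. \<bar>g x\<bar> \<le> B"
    and "\<And>x. x \<in> set_pmf p \<Longrightarrow> \<bar>f x - g x\<bar> \<le> d"
  shows "\<bar>measure_pmf.expectation p f - measure_pmf.expectation p g\<bar> \<le> d"
  using expectation_diff_le[of f B g "\<lambda>_. d" "\<bar>d\<bar>" p] assms by simp

lemma abs_expectation_le:
  fixes f :: "'a \<Rightarrow> real"
  assumes "\<And>x. \<bar>f x\<bar> \<le> B"
  shows "\<bar>measure_pmf.expectation p f\<bar> \<le> B"
  using expectation_diff_le_const[of f B "\<lambda>_. 0" p B] assms
  by (simp add: order_trans[OF abs_ge_zero assms])

text \<open>Boundedness makes the integrand nonnegative after adding a constant, which reduces the claim
  to the nonnegative integral, where it holds unconditionally.\<close>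

lemma expectation_bind_bounded:
  fixes f :: "'b \<Rightarrow> real"
  assumes f: "\<And>x. \<bar>f x\<bar> \<le> B"
  shows "measure_pmf.expectation (bind_pmf p q) f =
    measure_pmf.expectation p (\<lambda>x. measure_pmf.expectation (q x) f)"
proof -
  have nn: "0 \<le> f x + B" for x using f[of x] by linarith
  have bd: "\<bar>f x + B\<bar> \<le> 2 * B" for x using f[of x] by linarith
  have shift: "measure_pmf.expectation r (\<lambda>x. f x + B) = measure_pmf.expectation r f + B" for r
    using integrable_pmf_bounded[of f B r, OF f] by simp
  have enn: "(\<integral>\<^sup>+x. ennreal (f x + B) \<partial>measure_pmf r) = ennreal (measure_pmf.expectation r f + B)" for r
    using nn_integral_eq_integral[OF integrable_pmf_bounded[of _ _ r, OF bd]] nn by (simp add: shift)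
  have bE: "\<bar>measure_pmf.expectation (q x) f\<bar> \<le> B" for x by (rule abs_expectation_le[OF f])
  have nnE: "0 \<le> measure_pmf.expectation (q x) f + B" for x using bE[of x] by linarith
  have bdE: "\<bar>measure_pmf.expectation (q x) f + B\<bar> \<le> 2 * B" for x using bE[of x] by linarith
  have "ennreal (measure_pmf.expectation (bind_pmf p q) f + B) =
      (\<integral>\<^sup>+x. ennreal (measure_pmf.expectation (q x) f + B) \<partial>measure_pmf p)"
    unfolding enn[symmetric] by (rule nn_integral_bind_pmf)
  also have "\<dots> = ennreal (measure_pmf.expectation p (\<lambda>x. measure_pmf.expectation (q x) f + B))"
    using nn_integral_eq_integral[OF integrable_pmf_bounded[of _ _ p, OF bdE]] nnE by simp
  also have "measure_pmf.expectation p (\<lambda>x. measure_pmf.expectation (q x) f + B) =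
      measure_pmf.expectation p (\<lambda>x. measure_pmf.expectation (q x) f) + B"
    using integrable_pmf_bounded[of _ B p, OF bE] by simp
  finally have "measure_pmf.expectation (bind_pmf p q) f + B =
      measure_pmf.expectation p (\<lambda>x. measure_pmf.expectation (q x) f) + B"
    using abs_expectation_le[of f B "bind_pmf p q", OF f]
      abs_expectation_le[of "\<lambda>x. measure_pmf.expectation (q x) f" B p, OF bE]
    by (subst (asm) ennreal_inj) linarith+
  then show ?thesis by simp
qed

text \<open>Testing against all bounded functions expresses, up to a factor of two, that the
  distributions of \<open>\<phi> g x\<close> for \<open>g\<close> distributed by \<open>\<nu>\<close> are \<open>\<epsilon>\<close>-close to each other in total
  variation when \<open>x\<close> varies over \<open>A\<close>. This form is stable under composition of measures without
  any reference to densities.\<close>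

definition equalizes ::
    "('g \<Rightarrow> 'y \<Rightarrow> 'y) \<Rightarrow> 'y set \<Rightarrow> real \<Rightarrow> 'g pmf \<Rightarrow> bool" where
  "equalizes \<phi> A \<epsilon> \<nu> \<longleftrightarrow>
     (\<forall>x\<in>A. \<forall>y\<in>A. \<forall>h::'y \<Rightarrow> real. \<forall>B. (\<forall>z. \<bar>h z\<bar> \<le> B) \<longrightarrow>
        \<bar>measure_pmf.expectation \<nu> (\<lambda>g. h (\<phi> g x)) - measure_pmf.expectation \<nu> (\<lambda>g. h (\<phi> g y))\<bar> \<le> \<epsilon> * B)"

lemma equalizesD:
  fixes h :: "'y \<Rightarrow> real"
  assumes "equalizes \<phi> A \<epsilon> \<nu>" "x \<in> A" "y \<in> A" "\<And>z. \<bar>h z\<bar> \<le> B"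
  shows "\<bar>measure_pmf.expectation \<nu> (\<lambda>g. h (\<phi> g x)) - measure_pmf.expectation \<nu> (\<lambda>g. h (\<phi> g y))\<bar> \<le> \<epsilon> * B"
  using assms unfolding equalizes_def by blast

primrec reach :: "('g \<Rightarrow> 'y \<Rightarrow> 'y) \<Rightarrow> 'g set \<Rightarrow> 'y set \<Rightarrow> nat \<Rightarrow> 'y set" where
  "reach \<phi> S A 0 = A"
| "reach \<phi> S A (Suc n) = reach \<phi> S A n \<union> (\<Union>g\<in>S. \<phi> g ` reach \<phi> S A n)"

lemma finite_reach: "finite S \<Longrightarrow> finite A \<Longrightarrow> finite (reach \<phi> S A n)"
  by (induction n) auto

lemma reach_subset:
  assumes "\<And>g x. g \<in> S \<Longrightarrow> x \<in> Y \<Longrightarrow> \<phi> g x \<in> Y" "A \<subseteq> Y"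
  shows "reach \<phi> S A n \<subseteq> Y"
  using assms by (induction n) auto

lemma reach_mono_steps: "m \<le> n \<Longrightarrow> reach \<phi> S A m \<subseteq> reach \<phi> S A n"
  by (induction n) (auto simp: le_Suc_eq)

lemma reach_mono: "S \<subseteq> T \<Longrightarrow> A \<subseteq> A' \<Longrightarrow> reach \<phi> S A n \<subseteq> reach \<phi> T A' n"
  by (induction n) fastforce+

lemma transition_eq_pmf:
  assumes "set_pmf \<mu> \<subseteq> carrier G"
  shows "transition G \<phi> \<mu> x y = pmf (map_pmf (\<lambda>g. \<phi> g x) \<mu>) y"
proof -
  have "transition G \<phi> \<mu> x y = infsetsum (pmf \<mu>) {g \<in> carrier G. \<phi> g x = y}"
    unfolding transition_def by (subst infsetsum_infsum) (auto simp: pmf_abs_summable)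
  also have "\<dots> = measure \<mu> {g \<in> carrier G. \<phi> g x = y}"
    by (simp add: measure_pmf_conv_infsetsum)
  also have "\<dots> = measure \<mu> ((\<lambda>g. \<phi> g x) -` {y})"
    using assms by (intro measure_pmf.finite_measure_eq_AE) (auto simp: AE_measure_pmf_iff)
  finally show ?thesis by (simp add: pmf_map)
qed

text \<open>Grouping the group elements by the image of \<open>x\<close> turns the sum over \<open>Y\<close> that defines
  harmonicity into an average over the group.\<close>

lemma harmonic_expectation:
  assumes Y: "\<And>g x. g \<in> carrier G \<Longrightarrow> x \<in> Y \<Longrightarrow> \<phi> g x \<in> Y"
    and mu: "set_pmf \<mu> \<subseteq> carrier G"
    and f: "harmonic G Y \<phi> \<mu> f" and B: "\<And>y. \<bar>f y\<bar> \<le> B" and x: "x \<in> Y"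
  shows "f x = measure_pmf.expectation \<mu> (\<lambda>g. f (\<phi> g x))"
proof -
  define q where "q = map_pmf (\<lambda>g. \<phi> g x) \<mu>"
  have q0: "pmf q y = 0" if "y \<notin> Y" for y
    using that Y x mu by (auto simp: q_def pmf_eq_0_set_pmf)
  have "((\<lambda>y. f y * pmf q y) has_sum f x) Y"
    using f x unfolding harmonic_def q_def transition_eq_pmf[OF mu] by blast
  then have "((\<lambda>y. pmf q y * f y) has_sum f x) UNIV"
    using has_sum_cong_neutral[of UNIV Y "\<lambda>y. pmf q y * f y" "\<lambda>y. f y * pmf q y"]
    by (auto simp: q0 mult.commute)
  then have "f x = infsum (\<lambda>y. pmf q y * f y) UNIV" by (simp add: infsumI)
  also have "\<dots> = infsetsum (\<lambda>y. pmf q y * f y) UNIV"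
  proof (rule infsetsum_infsum[symmetric])
    show "Infinite_Set_Sum.abs_summable_on (\<lambda>y. pmf q y * f y) UNIV"
      by (rule abs_summable_on_comparison_test'[of "\<lambda>y. B * pmf q y"])
        (use B in \<open>auto simp: pmf_abs_summable abs_mult mult.commute intro!: mult_right_mono\<close>)
  qed
  also have "\<dots> = measure_pmf.expectation q f"
    by (simp add: pmf_expectation_eq_infsetsum)
  finally show ?thesis by (simp add: q_def)
qed

text \<open>A small mass at any prescribed group element costs little; this is how the mixture of the
  equalizing measures acquires full support.\<close>

lemma equalizes_mix:
  fixes \<phi> :: "'g \<Rightarrow> 'y \<Rightarrow> 'y"
  assumes \<nu>: "equalizes \<phi> A \<epsilon> \<nu>" and p: "0 \<le> p" "p \<le> 1"
  shows "equalizes \<phi> A (\<epsilon> + 2 * p) (bind_pmf (bernoulli_pmf p) (\<lambda>b. if b then return_pmf g else \<nu>))"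
  unfolding equalizes_def
proof (intro ballI allI impI)
  fix x y :: 'y and h :: "'y \<Rightarrow> real" and B
  assume xy: "x \<in> A" "y \<in> A" and B: "\<forall>z. \<bar>h z\<bar> \<le> B"
  let ?E = "\<lambda>x. measure_pmf.expectation \<nu> (\<lambda>g. h (\<phi> g x))"
  have mix: "measure_pmf.expectation (bind_pmf (bernoulli_pmf p) (\<lambda>b. if b then return_pmf g else \<nu>))
      (\<lambda>g. h (\<phi> g x)) = p * h (\<phi> g x) + (1 - p) * ?E x" for x
    using p B by (subst expectation_bind_bounded[where B = B]) auto
  have "0 \<le> \<epsilon> * B" using equalizesD[OF \<nu> xy(1) xy(1), of h B] B by simp
  have "(1 - p) * ?E x - (1 - p) * ?E y = (1 - p) * (?E x - ?E y)"
    by (simp add: algebra_simps)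
  then have "\<bar>(1 - p) * ?E x - (1 - p) * ?E y\<bar> \<le> (1 - p) * (\<epsilon> * B)"
    using equalizesD[OF \<nu> xy, of h B] B p by (auto simp: abs_mult intro!: mult_left_mono)
  also have "\<dots> \<le> 1 * (\<epsilon> * B)" using p \<open>0 \<le> \<epsilon> * B\<close> by (intro mult_right_mono) auto
  finally have 1: "\<bar>(1 - p) * ?E x - (1 - p) * ?E y\<bar> \<le> \<epsilon> * B" by simp
  have hxy: "\<bar>h (\<phi> g x) - h (\<phi> g y)\<bar> \<le> 2 * B"
    using B[rule_format, of "\<phi> g x"] B[rule_format, of "\<phi> g y"] by linarith
  have "p * h (\<phi> g x) - p * h (\<phi> g y) = p * (h (\<phi> g x) - h (\<phi> g y))"
    by (simp add: algebra_simps)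
  then have "\<bar>p * h (\<phi> g x) - p * h (\<phi> g y)\<bar> \<le> p * (2 * B)"
    using p hxy by (auto simp: abs_mult intro!: mult_left_mono)
  then show "\<bar>measure_pmf.expectation (bind_pmf (bernoulli_pmf p) (\<lambda>b. if b then return_pmf g else \<nu>)) (\<lambda>g. h (\<phi> g x))
      - measure_pmf.expectation (bind_pmf (bernoulli_pmf p) (\<lambda>b. if b then return_pmf g else \<nu>)) (\<lambda>g. h (\<phi> g y))\<bar>
      \<le> (\<epsilon> + 2 * p) * B"
    unfolding mix using 1 by (simp add: algebra_simps)
qed

lemma nondegenerate_full_support:
  assumes "group G" "set_pmf \<mu> = carrier G"
  shows "nondegenerate G \<mu>"
proof -
  interpret group G by fact
  have "x \<in> carrier G" if "x \<in> semigroup_generated G (set_pmf \<mu>)" for x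
    using that by induction (auto simp: assms(2))
  then show ?thesis
    unfolding nondegenerate_def using assms(2) by (auto intro: semigroup_generated.incl)
qed

lemma geometric_half_lessThan:
  "measure (geometric_pmf (1/2)) {..<i} = 1 - (1/2) ^ i"
proof -
  have "measure (geometric_pmf (1/2)) {..<i} = (\<Sum>j<i. (1/2) ^ j * (1/2 :: real))"
    by (simp add: measure_measure_pmf_finite)
  also have "\<dots> = 1 - (1/2) ^ i" by (induction i) (simp_all add: field_simps)
  finally show ?thesis .
qed

text \<open>The harmonic equation is unfolded \<open>n\<close> times, but only along the indices \<open>j < i\<close>, whose group
  elements stay inside the finite set that grows by one step each time. An index \<open>j \<ge> i\<close> stops the
  unfolding, since \<open>\<nu> j\<close> equalizes the whole region. The part which is never stopped has
  probability \<open>(1 - (1/2) ^ i) ^ n\<close> and is bounded trivially.\<close>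

lemma harmonic_oscillation_le:
  fixes \<phi> :: "'g \<Rightarrow> 'y \<Rightarrow> 'y" and f :: "'y \<Rightarrow> real" and \<nu> :: "nat \<Rightarrow> 'g pmf"
  assumes f: "\<And>x. x \<in> Y \<Longrightarrow>
      f x = measure_pmf.expectation (bind_pmf (geometric_pmf (1/2)) \<nu>) (\<lambda>g. f (\<phi> g x))"
    and B: "\<And>x. \<bar>f x\<bar> \<le> B"
    and early: "\<And>j. j < i \<Longrightarrow> set_pmf (\<nu> j) \<subseteq> S"
    and late: "\<And>j. i \<le> j \<Longrightarrow> equalizes \<phi> (reach \<phi> S A n) \<epsilon> (\<nu> j)"
    and Y: "reach \<phi> S A n \<subseteq> Y" and "0 \<le> \<epsilon>"
    and xy: "x \<in> A" "y \<in> A"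
  shows "\<bar>f x - f y\<bar> \<le> \<epsilon> * B + 2 * B * (1 - (1/2) ^ i) ^ n"
proof -
  define a :: real where "a = 1 - (1/2) ^ i"
  have a: "0 \<le> a" by (simp add: a_def power_le_one)
  have "0 \<le> B" using B[of x] by linarith
  have "\<bar>f z - f w\<bar> \<le> \<epsilon> * B + 2 * B * a ^ m"
    if "m \<le> n" "z \<in> reach \<phi> S A (n - m)" "w \<in> reach \<phi> S A (n - m)" for m z w
    using that
  proof (induction m arbitrary: z w)
    case 0
    have "0 \<le> \<epsilon> * B" using \<open>0 \<le> \<epsilon>\<close> \<open>0 \<le> B\<close> by simp
    then show ?case using B[of z] B[of w] by simp
  next
    case (Suc m)
    define D where "D = 2 * B * a ^ m"
    have "0 \<le> D" using a \<open>0 \<le> B\<close> by (simp add: D_def)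
    have nm: "n - m = Suc (n - Suc m)" using Suc.prems by simp
    have in_n: "z \<in> reach \<phi> S A n" "w \<in> reach \<phi> S A n"
      using Suc.prems reach_mono_steps[of "n - Suc m" n \<phi> S A] by auto
    define \<psi> where "\<psi> z j = measure_pmf.expectation (\<nu> j) (\<lambda>g. f (\<phi> g z))" for z j
    have \<psi>B: "\<bar>\<psi> z j\<bar> \<le> B" for z j unfolding \<psi>_def by (rule abs_expectation_le) (rule B)
    have f\<psi>: "f z = measure_pmf.expectation (geometric_pmf (1/2)) (\<psi> z)"
      if "z \<in> reach \<phi> S A n" for z
    proof -
      have "f z = measure_pmf.expectation (bind_pmf (geometric_pmf (1/2)) \<nu>) (\<lambda>g. f (\<phi> g z))"
        using that Y by (intro f) auto
      also have "\<dots> = measure_pmf.expectation (geometric_pmf (1/2)) (\<psi> z)"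
        unfolding \<psi>_def using B by (rule expectation_bind_bounded)
      finally show ?thesis .
    qed
    \<comment> \<open>A late index contributes the equalization error; an early one moves both points one step
      outwards, where the induction hypothesis bounds the oscillation.\<close>
    let ?d = "\<lambda>j. \<epsilon> * B + D * indicator {..<i} j"
    have close: "\<bar>\<psi> z j - \<psi> w j\<bar> \<le> ?d j" for j
    proof (cases "j < i")
      case True
      have "\<bar>f (\<phi> g z) - f (\<phi> g w)\<bar> \<le> \<epsilon> * B + D" if "g \<in> set_pmf (\<nu> j)" for g
      proof -
        have "g \<in> S" using that early[OF True] by blast
        then have "\<phi> g z \<in> reach \<phi> S A (n - m)" "\<phi> g w \<in> reach \<phi> S A (n - m)"
          using Suc.prems unfolding nm by auto
        then show ?thesis using Suc.IH Suc.prems(1) unfolding D_def by simp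
      qed
      then have "\<bar>\<psi> z j - \<psi> w j\<bar> \<le> \<epsilon> * B + D"
        unfolding \<psi>_def using B by (intro expectation_diff_le_const[where B = B]) auto
      then show ?thesis using True by simp
    next
      case False
      then show ?thesis
        using equalizesD[OF late in_n, of j f B] B by (simp add: \<psi>_def)
    qed
    have "\<bar>f z - f w\<bar> \<le> measure_pmf.expectation (geometric_pmf (1/2)) ?d"
      unfolding f\<psi>[OF in_n(1)] f\<psi>[OF in_n(2)]
    proof (rule expectation_diff_le[OF \<psi>B \<psi>B _ close])
      show "\<bar>?d j\<bar> \<le> \<epsilon> * B + D" for j
        using \<open>0 \<le> D\<close> \<open>0 \<le> \<epsilon>\<close> \<open>0 \<le> B\<close> by (simp add: indicator_def)
    qed
    also have "\<dots> = \<epsilon> * B + D * a"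
      by (simp add: geometric_half_lessThan a_def measure_pmf.emeasure_eq_measure)
    finally show ?case by (simp add: D_def mult_ac)
  qed
  from this[of n x y] show ?thesis using xy by (simp add: a_def)
qed

text \<open>The number \<open>i * 2 ^ i\<close> of steps is chosen increasing in \<open>i\<close>, so that the controlled regions
  are nested, and large enough to make the unstopped probability vanish as \<open>i\<close> grows.\<close>

lemma decay_le: "(1 - (1/2 :: real) ^ i) ^ (i * 2 ^ i) \<le> exp (- real i)"
proof -
  have "(1 - (1/2 :: real) ^ i) ^ (i * 2 ^ i) \<le> exp (- ((1/2) ^ i)) ^ (i * 2 ^ i)"
    using exp_ge_add_one_self[of "- ((1/2 :: real) ^ i)"] by (intro power_mono) (auto simp: power_le_one)
  also have "\<dots> = exp (- real i)"
    by (simp add: exp_of_nat_mult[symmetric] power_divide)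
  finally show ?thesis .
qed

text \<open>The measures \<open>\<nu> i\<close> are chosen one after another: \<open>\<nu> i\<close> equalizes the finite set of points
  which are reachable in \<open>i * 2 ^ i\<close> steps from the first \<open>i\<close> points of \<open>Y\<close> by elements of the
  earlier supports, and it charges the \<open>i\<close>-th element of the group. The estimate
  \<open>harmonic_oscillation_le\<close> then applies for every \<open>i\<close>, and its bound tends to zero.\<close>

theorem liouville_criterion:
  fixes G :: "('g, 'm) monoid_scheme" and \<phi> :: "'g \<Rightarrow> 'y \<Rightarrow> 'y"
  assumes "group G" and closed: "\<And>g x. g \<in> carrier G \<Longrightarrow> x \<in> Y \<Longrightarrow> \<phi> g x \<in> Y"
    and cG: "countable (carrier G)" and cY: "countable Y"
    and eq: "\<And>A \<epsilon>. finite A \<Longrightarrow> A \<subseteq> Y \<Longrightarrow> 0 < \<epsilon> \<Longrightarrow>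
      \<exists>\<nu>. finite (set_pmf \<nu>) \<and> set_pmf \<nu> \<subseteq> carrier G \<and> equalizes \<phi> A \<epsilon> \<nu>"
  shows "liouville G Y \<phi>"
proof -
  interpret group G by fact
  have ne: "carrier G \<noteq> {}" by blast
  define e where "e = from_nat_into (carrier G)"
  have e: "e i \<in> carrier G" for i unfolding e_def by (rule from_nat_into[OF ne])
  \<comment> \<open>The intersection with \<open>Y\<close> matters only for empty \<open>Y\<close>, where the enumeration takes a default value.\<close>
  define pts where "pts i = from_nat_into Y ` {..<i} \<inter> Y" for i
  define W where "W S i = reach \<phi> S (pts i) (i * 2 ^ i)" for S i
  have W_sub: "W S i \<subseteq> Y" if "S \<subseteq> carrier G" for S i
    unfolding W_def using that closed by (intro reach_subset) (auto simp: pts_def)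
  have "\<exists>\<nu>. finite S \<and> S \<subseteq> carrier G \<longrightarrow> finite (set_pmf \<nu>) \<and> set_pmf \<nu> \<subseteq> carrier G \<and>
      e i \<in> set_pmf \<nu> \<and> equalizes \<phi> (W S i) (1 / Suc i) \<nu>" for S i
  proof (cases "finite S \<and> S \<subseteq> carrier G")
    case True
    \<comment> \<open>Half of the admissible error is for the equalization and half for the added point mass.\<close>
    define x :: real where "x = 1 / Suc i"
    define p where "p = x / 4"
    have p: "0 < p" "p < 1" by (auto simp: p_def x_def divide_simps)
    have "finite (W S i)" unfolding W_def using True by (intro finite_reach) (auto simp: pts_def)
    from eq[OF this, of "2 * p"] W_sub[of S i] obtain \<nu>
      where \<nu>: "finite (set_pmf \<nu>)" "set_pmf \<nu> \<subseteq> carrier G" "equalizes \<phi> (W S i) (2 * p) \<nu>"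
      using True p by auto
    let ?\<nu> = "bind_pmf (bernoulli_pmf p) (\<lambda>b. if b then return_pmf (e i) else \<nu>)"
    have "equalizes \<phi> (W S i) (2 * p + 2 * p) ?\<nu>" using p by (intro equalizes_mix \<nu>) auto
    also have "2 * p + 2 * p = x" by (simp add: p_def)
    finally have "equalizes \<phi> (W S i) (1 / Suc i) ?\<nu>" unfolding x_def .
    moreover have "set_pmf ?\<nu> = insert (e i) (set_pmf \<nu>)"
      using p by (auto simp: set_pmf_bernoulli UNIV_bool)
    ultimately show ?thesis using \<nu> e[of i] by (intro exI[of _ ?\<nu>]) simp
  qed blast
  then obtain N where N: "finite S \<Longrightarrow> S \<subseteq> carrier G \<Longrightarrow> finite (set_pmf (N S i)) \<and>
      set_pmf (N S i) \<subseteq> carrier G \<and> e i \<in> set_pmf (N S i) \<and>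
      equalizes \<phi> (W S i) (1 / Suc i) (N S i)" for S i
    by metis
  define S where "S = rec_nat {} (\<lambda>i S. S \<union> set_pmf (N S i))"
  define \<nu> where "\<nu> i = N (S i) i" for i
  have S_Suc: "S (Suc i) = S i \<union> set_pmf (\<nu> i)" for i by (simp add: S_def \<nu>_def)
  have S: "finite (S i) \<and> S i \<subseteq> carrier G" for i
  proof (induction i)
    case 0 show ?case by (simp add: S_def)
  next
    case (Suc i)
    then show ?case using N[of "S i" i] unfolding S_Suc by (simp add: \<nu>_def)
  qed
  have \<nu>: "set_pmf (\<nu> i) \<subseteq> carrier G" "e i \<in> set_pmf (\<nu> i)"
    "equalizes \<phi> (W (S i) i) (1 / Suc i) (\<nu> i)" for i
    using N[of "S i" i] S[of i] by (auto simp: \<nu>_def)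
  have S_mono: "i \<le> j \<Longrightarrow> S i \<subseteq> S j" for i j
    by (induction j) (auto simp: le_Suc_eq S_Suc)
  define \<mu> where "\<mu> = bind_pmf (geometric_pmf (1/2)) \<nu>"
  have "carrier G \<subseteq> (\<Union>i. set_pmf (\<nu> i))"
  proof
    fix g assume "g \<in> carrier G"
    then have "g = e (to_nat_on (carrier G) g)" by (simp add: e_def cG)
    then show "g \<in> (\<Union>i. set_pmf (\<nu> i))" using \<nu>(2) by (metis UNIV_I UN_iff)
  qed
  then have set_\<mu>: "set_pmf \<mu> = carrier G"
    using \<nu>(1) by (auto simp: \<mu>_def set_pmf_geometric)
  have "f constant_on Y" if bd: "bounded (f ` Y)" and harm: "harmonic G Y \<phi> \<mu> f" for f
  proof -
    obtain B where B: "\<And>y. y \<in> Y \<Longrightarrow> \<bar>f y\<bar> \<le> B"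
      using bd by (auto simp: bounded_iff)
    \<comment> \<open>Outside \<open>Y\<close> nothing is known about \<open>f\<close>; extending by zero makes it bounded everywhere.\<close>
    define f' where "f' y = (if y \<in> Y then f y else 0)" for y
    have f'B: "\<bar>f' y\<bar> \<le> \<bar>B\<bar>" for y using B[of y] by (auto simp: f'_def)
    have "harmonic G Y \<phi> \<mu> f'"
      unfolding harmonic_def
    proof
      fix x assume x: "x \<in> Y"
      then have "((\<lambda>y. f y * transition G \<phi> \<mu> x y) has_sum f' x) Y"
        using harm by (simp add: harmonic_def f'_def)
      then show "((\<lambda>y. f' y * transition G \<phi> \<mu> x y) has_sum f' x) Y"
        by (subst has_sum_cong[of Y _ "\<lambda>y. f y * transition G \<phi> \<mu> x y"]) (simp_all add: f'_def)
    qed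
    then have f'E: "f' x = measure_pmf.expectation \<mu> (\<lambda>g. f' (\<phi> g x))" if "x \<in> Y" for x
      using closed set_\<mu> f'B that by (intro harmonic_expectation[where B = "\<bar>B\<bar>"]) auto
    have bound: "\<bar>f' x - f' y\<bar> \<le> 1 / Suc i * \<bar>B\<bar> + 2 * \<bar>B\<bar> * exp (- real i)"
      if xy: "x \<in> pts i" "y \<in> pts i" for x y i
    proof -
      have "\<bar>f' x - f' y\<bar> \<le> 1 / Suc i * \<bar>B\<bar> + 2 * \<bar>B\<bar> * (1 - (1/2) ^ i) ^ (i * 2 ^ i)"
      proof (rule harmonic_oscillation_le[where S = "S i" and A = "pts i" and Y = Y and \<nu> = \<nu> and \<phi> = \<phi>])
        show "set_pmf (\<nu> j) \<subseteq> S i" if "j < i" for j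
          using S_mono[of "Suc j" i] that by (auto simp: S_Suc)
        show "reach \<phi> (S i) (pts i) (i * 2 ^ i) \<subseteq> Y"
          using W_sub S unfolding W_def by blast
        show "equalizes \<phi> (reach \<phi> (S i) (pts i) (i * 2 ^ i)) (1 / Suc i) (\<nu> j)" if "i \<le> j" for j
          unfolding equalizes_def
        proof (intro ballI allI impI)
          fix z w :: 'y and h :: "'y \<Rightarrow> real" and C
          assume zw: "z \<in> reach \<phi> (S i) (pts i) (i * 2 ^ i)" "w \<in> reach \<phi> (S i) (pts i) (i * 2 ^ i)"
            and C: "\<forall>z. \<bar>h z\<bar> \<le> C"
          have "reach \<phi> (S i) (pts i) (i * 2 ^ i) \<subseteq> reach \<phi> (S i) (pts i) (j * 2 ^ j)"
            using that by (intro reach_mono_steps mult_mono power_increasing) auto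
          also have "\<dots> \<subseteq> W (S j) j"
            unfolding W_def using that by (intro reach_mono S_mono) (auto simp: pts_def)
          finally have "\<bar>measure_pmf.expectation (\<nu> j) (\<lambda>g. h (\<phi> g z)) -
              measure_pmf.expectation (\<nu> j) (\<lambda>g. h (\<phi> g w))\<bar> \<le> 1 / Suc j * C"
            using zw C by (intro equalizesD[OF \<nu>(3)]) auto
          also have "0 \<le> C" using C abs_ge_zero order_trans by blast
          then have "1 / Suc j * C \<le> 1 / Suc i * C"
            using that by (intro mult_right_mono divide_left_mono) auto
          finally show "\<bar>measure_pmf.expectation (\<nu> j) (\<lambda>g. h (\<phi> g z)) -
              measure_pmf.expectation (\<nu> j) (\<lambda>g. h (\<phi> g w))\<bar> \<le> 1 / Suc i * C" .
        qed
      qed (use f'E f'B xy in \<open>auto simp: \<mu>_def\<close>)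
      also have "\<dots> \<le> 1 / Suc i * \<bar>B\<bar> + 2 * \<bar>B\<bar> * exp (- real i)"
        by (intro add_left_mono mult_left_mono decay_le) auto
      finally show ?thesis .
    qed
    have lim: "(\<lambda>i. 1 / Suc i * \<bar>B\<bar> + 2 * \<bar>B\<bar> * exp (- real i)) \<longlonglongrightarrow> 0"
    proof -
      have "(\<lambda>i. exp (- real i)) \<longlonglongrightarrow> 0"
        using LIMSEQ_power_zero[of "exp (-1 :: real)"] by (simp add: exp_of_nat_mult[symmetric])
      moreover have "(\<lambda>i. 1 / real (Suc i)) \<longlonglongrightarrow> 0"
        using LIMSEQ_inverse_real_of_nat by (simp add: inverse_eq_divide)
      ultimately have "(\<lambda>i. 1 / Suc i * \<bar>B\<bar> + 2 * \<bar>B\<bar> * exp (- real i)) \<longlonglongrightarrow> 0 * \<bar>B\<bar> + 2 * \<bar>B\<bar> * 0"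
        by (intro tendsto_intros)
      then show ?thesis by simp
    qed
    have "f x = f y" if xy: "x \<in> Y" "y \<in> Y" for x y
    proof -
      define m where "m = Suc (max (to_nat_on Y x) (to_nat_on Y y))"
      have in_pts: "x \<in> pts i \<and> y \<in> pts i" if "m \<le> i" for i
      proof -
        have "x = from_nat_into Y (to_nat_on Y x)" "y = from_nat_into Y (to_nat_on Y y)"
          using xy cY by simp_all
        moreover have "to_nat_on Y x < i" "to_nat_on Y y < i" using that by (auto simp: m_def)
        ultimately show ?thesis using xy unfolding pts_def by blast
      qed
      have "\<bar>f' x - f' y\<bar> \<le> 0"
        using bound in_pts
        by (intro tendsto_lowerbound[OF lim] eventually_mono[OF eventually_ge_at_top[of m]]) auto
      then show ?thesis using xy by (simp add: f'_def)
    qed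
    then show ?thesis unfolding constant_on_def by blast
  qed
  then have "measure_liouville G Y \<phi> \<mu>" unfolding measure_liouville_def by blast
  moreover have "nondegenerate G \<mu>"
    using \<open>group G\<close> set_\<mu> by (rule nondegenerate_full_support)
  ultimately show ?thesis unfolding liouville_def by blast
qed

section \<open>Random increasing sequences with almost equally distributed pairs\<close>

definition uniform :: "nat \<Rightarrow> nat pmf" where
  "uniform N = pmf_of_set {..<N}"

lemma set_uniform: "0 < N \<Longrightarrow> set_pmf (uniform N) = {..<N}"
  unfolding uniform_def by (rule set_pmf_of_set) (auto simp: lessThan_empty_iff)

lemma expectation_uniform:
  "0 < N \<Longrightarrow> measure_pmf.expectation (uniform N) h = (\<Sum>x<N. h x) / real N"
  unfolding uniform_def by (subst integral_pmf_of_set) (auto simp: lessThan_empty_iff)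

text \<open>Shifting by one changes the sum over the interval only at its two ends.\<close>

lemma uniform_shift:
  assumes N: "0 < N" and B: "\<And>x. \<bar>h x\<bar> \<le> B"
  shows "\<bar>measure_pmf.expectation (uniform N) (\<lambda>x. h (c + x)) - measure_pmf.expectation (uniform N) h\<bar>
    \<le> 2 * B * (real c / real N)"
proof -
  have "\<bar>(\<Sum>x<N. h (c + x)) - (\<Sum>x<N. h x)\<bar> \<le> real c * (2 * B)"
  proof (induction c)
    case (Suc c)
    have "h c + (\<Sum>x<N. h (Suc c + x)) = h (c + N) + (\<Sum>x<N. h (c + x))"
      using sum.lessThan_Suc_shift[of "\<lambda>x. h (c + x)" N] by simp
    then show ?case
      using Suc.IH B[of c] B[of "c + N"] by (simp add: algebra_simps)
  qed simp
  then have "\<bar>(\<Sum>x<N. h (c + x)) - (\<Sum>x<N. h x)\<bar> / real N \<le> real c * (2 * B) / real N"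
    by (rule divide_right_mono) simp
  then show ?thesis
    using N by (simp add: expectation_uniform mult_ac flip: diff_divide_distrib)
qed

text \<open>Increments are \<open>Suc (d l)\<close> so that the walk is strictly increasing whatever \<open>d\<close> is.\<close>

definition walk :: "(nat \<Rightarrow> nat) \<Rightarrow> nat \<Rightarrow> nat \<Rightarrow> nat" where
  "walk d u i = u + (\<Sum>l\<le>i. Suc (d l))"

lemma strict_mono_walk: "strict_mono (walk d u)"
  unfolding walk_def by (rule strict_monoI_Suc) simp

definition increments :: "nat \<Rightarrow> nat \<Rightarrow> nat \<Rightarrow> (nat \<Rightarrow> nat) pmf" where
  "increments M k r = Pi_pmf {..<k} 0 (\<lambda>l. uniform (M ^ (r + l)))"

text \<open>The range of the starting point exceeds all the scales \<open>n ^ (r + l)\<close> by a factor \<open>n\<close> at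
  least. A single parameter \<open>n\<close> serves as the base of the scales and as the length of the range of
  \<open>r\<close>.\<close>

definition random_walk :: "nat \<Rightarrow> nat \<Rightarrow> (nat \<Rightarrow> nat) pmf" where
  "random_walk n k =
     bind_pmf (uniform n) (\<lambda>r. bind_pmf (increments n k r) (\<lambda>d.
       map_pmf (walk d) (uniform (n ^ (n + k + 1)))))"

text \<open>The limiting distribution of a pair on scale \<open>s\<close>: a uniform starting point, and
  independently of it a uniform distance.\<close>

definition pair_average :: "nat \<Rightarrow> nat \<Rightarrow> (nat \<Rightarrow> nat \<Rightarrow> real) \<Rightarrow> nat \<Rightarrow> real" where
  "pair_average M L h s = measure_pmf.expectation (uniform (M ^ s)) (\<lambda>t.
     measure_pmf.expectation (uniform L) (\<lambda>u. h u (u + t)))"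

text \<open>With all increments but the \<open>j\<close>-th fixed, \<open>walk d u i\<close> is \<open>u\<close> shifted by some \<open>s\<close>, and the
  distance to \<open>walk d u j\<close> is the \<open>j\<close>-th increment shifted by some \<open>c\<close>. Both shifts are sums of at
  most \<open>k\<close> terms from smaller scales, so each is at most \<open>k / M\<close> of the length of the interval
  over which \<open>u\<close> or the increment is averaged.\<close>

lemma walk_pair_average:
  assumes M: "0 < M" and ij: "i < j" "j < k" and r: "r < n" and B: "\<And>u v. \<bar>h u v\<bar> \<le> B"
  defines "L \<equiv> M ^ (n + k + 1)"
  shows "\<bar>measure_pmf.expectation (increments M k r) (\<lambda>d.
      measure_pmf.expectation (uniform L) (\<lambda>u. h (walk d u i) (walk d u j)))
     - pair_average M L h (r + j)\<bar> \<le> 4 * B * (real k / real M)"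
proof -
  have B0: "0 \<le> B" using B[of 0 0] by linarith
  have L: "0 < L" using M by (simp add: L_def)
  define rest where "rest = Pi_pmf ({..<k} - {j}) 0 (\<lambda>l. uniform (M ^ (r + l)))"
  define H where "H d = measure_pmf.expectation (uniform L) (\<lambda>u. h (walk d u i) (walk d u j))" for d
  have HB: "\<bar>H d\<bar> \<le> B" for d unfolding H_def by (rule abs_expectation_le) (rule B)
  have "insert j ({..<k} - {j}) = {..<k}" using ij by auto
  then have "increments M k r =
      bind_pmf (uniform (M ^ (r + j))) (\<lambda>t. bind_pmf rest (\<lambda>g. return_pmf (g(j := t))))"
    using Pi_pmf_insert'[of "{..<k} - {j}" j 0 "\<lambda>l. uniform (M ^ (r + l))"]
    by (simp add: increments_def rest_def)
  also have "\<dots> = bind_pmf rest (\<lambda>g. map_pmf (\<lambda>t. g(j := t)) (uniform (M ^ (r + j))))"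
    unfolding map_pmf_def by (rule bind_commute_pmf)
  finally have incr: "increments M k r =
      bind_pmf rest (\<lambda>g. map_pmf (\<lambda>t. g(j := t)) (uniform (M ^ (r + j))))" .
  have "measure_pmf.expectation (increments M k r) H =
      measure_pmf.expectation rest (\<lambda>g. measure_pmf.expectation (uniform (M ^ (r + j))) (\<lambda>t. H (g(j := t))))"
    unfolding incr by (subst expectation_bind_bounded[OF HB]) simp
  moreover have "\<bar>measure_pmf.expectation rest (\<lambda>g. measure_pmf.expectation (uniform (M ^ (r + j))) (\<lambda>t. H (g(j := t))))
      - measure_pmf.expectation rest (\<lambda>_. pair_average M L h (r + j))\<bar> \<le> 4 * B * (real k / real M)"
  proof (rule expectation_diff_le_const[where B = B])
    show "\<bar>measure_pmf.expectation (uniform (M ^ (r + j))) (\<lambda>t. H (g(j := t)))\<bar> \<le> B" for g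
      by (rule abs_expectation_le) (rule HB)
    show "\<bar>pair_average M L h (r + j)\<bar> \<le> B"
      unfolding pair_average_def by (intro abs_expectation_le B)
    fix g assume "g \<in> set_pmf rest"
    then have g: "Suc (g l) \<le> M ^ (r + l)" if "l < k" "l \<noteq> j" for l
      using that M by (auto simp: rest_def set_Pi_pmf PiE_dflt_def set_uniform)
    \<comment> \<open>The two shifts; the summand one in \<open>c\<close> comes from the increment \<open>Suc (d j)\<close> itself.\<close>
    define s where "s = (\<Sum>l\<le>i. Suc (g l))"
    define c where "c = Suc (\<Sum>l\<in>{i<..<j}. Suc (g l))"
    have wi: "walk (g(j := t)) u i = s + u" for t u
      using ij by (auto simp: walk_def s_def intro!: sum.cong)
    have "{..j} = insert j ({..i} \<union> {i<..<j})" using ij by auto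
    then have "(\<Sum>l\<le>j. Suc ((g(j := t)) l)) = Suc t + ((\<Sum>l\<le>i. Suc (g l)) + (\<Sum>l\<in>{i<..<j}. Suc (g l)))" for t
      using ij by (simp add: sum.union_disjoint ivl_disj_int)
    then have wj: "walk (g(j := t)) u j = s + u + (c + t)" for t u
      by (simp add: walk_def s_def c_def)
    have "s \<le> (\<Sum>l\<le>i. M ^ (n + k))"
      unfolding s_def using ij r M
      by (intro sum_mono order_trans[OF g] power_increasing) auto
    also have "\<dots> = Suc i * M ^ (n + k)" by simp
    also have "\<dots> \<le> k * M ^ (n + k)" using ij by (intro mult_right_mono) auto
    finally have s_le: "s \<le> k * M ^ (n + k)" .
    define m where "m = r + j - 1"
    have rj: "r + j = Suc m" using ij by (simp add: m_def)
    have "(\<Sum>l\<in>{i<..<j}. Suc (g l)) \<le> (\<Sum>l\<in>{i<..<j}. M ^ m)"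
      using ij M by (intro sum_mono order_trans[OF g] power_increasing) (auto simp: m_def)
    also have "\<dots> = (j - Suc i) * M ^ m" by simp
    finally have "c \<le> M ^ m + (j - Suc i) * M ^ m"
      unfolding c_def using one_le_power[of M m] M by linarith
    also have "\<dots> = Suc (j - Suc i) * M ^ m" by simp
    also have "\<dots> \<le> k * M ^ m" using ij by (intro mult_right_mono) auto
    finally have c_le: "c \<le> k * M ^ m" .
    have "real s / real L \<le> real (k * M ^ (n + k)) / real L"
      using s_le by (intro divide_right_mono) (simp_all only: of_nat_le_iff of_nat_0_le_iff)
    also have "\<dots> = real k / real M" using M by (simp add: L_def)
    finally have s_ratio: "2 * B * (real s / real L) \<le> 2 * B * (real k / real M)"
      using B0 by (intro mult_left_mono) auto
    have "real c / real (M ^ (r + j)) \<le> real (k * M ^ m) / real (M ^ (r + j))"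
      using c_le by (intro divide_right_mono) (simp_all only: of_nat_le_iff of_nat_0_le_iff)
    also have "\<dots> = real k / real M" unfolding rj using M by simp
    finally have c_ratio: "2 * B * (real c / real (M ^ (r + j))) \<le> 2 * B * (real k / real M)"
      using B0 by (intro mult_left_mono) auto
    define \<Phi> where "\<Phi> t = measure_pmf.expectation (uniform L) (\<lambda>u. h u (u + t))" for t
    have \<Phi>B: "\<bar>\<Phi> t\<bar> \<le> B" for t unfolding \<Phi>_def by (rule abs_expectation_le) (rule B)
    have "\<bar>H (g(j := t)) - \<Phi> (c + t)\<bar> \<le> 2 * B * (real k / real M)" for t
      using uniform_shift[OF L, of "\<lambda>u. h u (u + (c + t))" B s] B s_ratio
      by (simp add: H_def \<Phi>_def wi wj)
    then have "\<bar>measure_pmf.expectation (uniform (M ^ (r + j))) (\<lambda>t. H (g(j := t)))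
        - measure_pmf.expectation (uniform (M ^ (r + j))) (\<lambda>t. \<Phi> (c + t))\<bar> \<le> 2 * B * (real k / real M)"
      by (intro expectation_diff_le_const[where B = B] HB \<Phi>B)
    moreover have "\<bar>measure_pmf.expectation (uniform (M ^ (r + j))) (\<lambda>t. \<Phi> (c + t))
        - pair_average M L h (r + j)\<bar> \<le> 2 * B * (real k / real M)"
      using uniform_shift[of "M ^ (r + j)" \<Phi> B c] \<Phi>B M c_ratio
      by (simp add: pair_average_def \<Phi>_def[abs_def])
    ultimately show "\<bar>measure_pmf.expectation (uniform (M ^ (r + j))) (\<lambda>t. H (g(j := t)))
        - pair_average M L h (r + j)\<bar> \<le> 4 * B * (real k / real M)"
      by linarith
  qed
  ultimately show ?thesis unfolding H_def[abs_def] by simp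
qed

text \<open>Averaging over the random scale makes \<open>r + j\<close> interchangeable with \<open>r\<close>, so that the
  comparison distribution depends neither on \<open>i\<close> nor on \<open>j\<close>.\<close>

lemma random_walk_pair_average:
  assumes n: "0 < n" and ij: "i < j" "j < k" and B: "\<And>u v. \<bar>h u v\<bar> \<le> B"
  defines "L \<equiv> n ^ (n + k + 1)"
  shows "\<bar>measure_pmf.expectation (random_walk n k) (\<lambda>Z. h (Z i) (Z j))
    - measure_pmf.expectation (uniform n) (pair_average n L h)\<bar> \<le> 6 * B * (real k / real n)"
proof -
  have B0: "0 \<le> B" using B[of 0 0] by linarith
  define E where "E r = measure_pmf.expectation (increments n k r) (\<lambda>d.
      measure_pmf.expectation (uniform L) (\<lambda>u. h (walk d u i) (walk d u j)))" for r
  have EB: "\<bar>E r\<bar> \<le> B" for r unfolding E_def by (intro abs_expectation_le B)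
  have PB: "\<bar>pair_average n L h s\<bar> \<le> B" for s
    unfolding pair_average_def by (intro abs_expectation_le B)
  have "measure_pmf.expectation (random_walk n k) (\<lambda>Z. h (Z i) (Z j)) = measure_pmf.expectation (uniform n) E"
    using B unfolding random_walk_def E_def L_def
    by (simp add: expectation_bind_bounded[where B = B])
  moreover have "\<bar>measure_pmf.expectation (uniform n) E
      - measure_pmf.expectation (uniform n) (\<lambda>r. pair_average n L h (j + r))\<bar> \<le> 4 * B * (real k / real n)"
  proof (rule expectation_diff_le_const[OF EB PB])
    fix r assume "r \<in> set_pmf (uniform n)"
    then have "r < n" using n by (simp add: set_uniform)
    then show "\<bar>E r - pair_average n L h (j + r)\<bar> \<le> 4 * B * (real k / real n)"
      using walk_pair_average[OF n ij _ B, of r n] by (simp add: E_def L_def add.commute)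
  qed
  moreover have "\<bar>measure_pmf.expectation (uniform n) (\<lambda>r. pair_average n L h (j + r))
      - measure_pmf.expectation (uniform n) (pair_average n L h)\<bar> \<le> 2 * B * (real j / real n)"
    using n PB by (rule uniform_shift)
  moreover have "2 * B * (real j / real n) \<le> 2 * B * (real k / real n)"
    using ij B0 by (intro mult_left_mono divide_right_mono) auto
  ultimately show ?thesis by linarith
qed

lemma set_random_walk:
  assumes "0 < n"
  shows "finite (set_pmf (random_walk n k))" "Z \<in> set_pmf (random_walk n k) \<Longrightarrow> strict_mono Z"
proof -
  have "finite (set_pmf (increments n k r))" for r
    unfolding increments_def using assms by (auto simp: set_Pi_pmf set_uniform intro!: finite_PiE_dflt)
  then show "finite (set_pmf (random_walk n k))"
    using assms by (auto simp: random_walk_def set_uniform)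
  show "strict_mono Z" if "Z \<in> set_pmf (random_walk n k)"
    using that by (auto simp: random_walk_def strict_mono_walk)
qed

text \<open>Exact equality is impossible for three terms with finite means: \<open>Z 1 - Z 0\<close>, \<open>Z 2 - Z 1\<close> and
  their sum \<open>Z 2 - Z 0\<close> would have the same mean, which is positive. An arbitrarily small error is
  enough to escape this.\<close>

theorem almost_pair_spreadable:
  assumes "0 < \<epsilon>"
  obtains Q :: "(nat \<Rightarrow> nat) pmf" where
    "finite (set_pmf Q)" "\<And>Z. Z \<in> set_pmf Q \<Longrightarrow> strict_mono Z"
    "\<forall>(h :: nat \<Rightarrow> nat \<Rightarrow> real) B i j i' j'. (\<forall>u v. \<bar>h u v\<bar> \<le> B) \<and>
       i < j \<and> j < k \<and> i' < j' \<and> j' < k \<longrightarrow>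
       \<bar>measure_pmf.expectation Q (\<lambda>Z. h (Z i) (Z j)) - measure_pmf.expectation Q (\<lambda>Z. h (Z i') (Z j'))\<bar> \<le> \<epsilon> * B"
proof -
  obtain n where n: "12 * real k / \<epsilon> < real n" using reals_Archimedean2 by blast
  have "0 \<le> 12 * real k / \<epsilon>" using assms by simp
  then have n0: "0 < n" using n by (cases n) auto
  have "12 * real k \<le> \<epsilon> * real n" using n assms by (simp add: field_simps)
  then have ratio: "12 * (real k / real n) \<le> \<epsilon>" using n0 by (simp add: field_simps)
  show thesis
  proof (rule that[of "random_walk n k"], goal_cases _ _ spread)
    case spread
    show ?case
    proof (intro allI impI, elim conjE)
      fix h :: "nat \<Rightarrow> nat \<Rightarrow> real" and B i j i' j'
      assume bound: "\<forall>u v. \<bar>h u v\<bar> \<le> B" and ij: "i < j" "j < k" and ij': "i' < j'" "j' < k"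
      have B: "\<bar>h u v\<bar> \<le> B" for u v using bound by blast
      have "0 \<le> B" using B[of 0 0] by linarith
      then have "12 * (real k / real n) * B \<le> \<epsilon> * B" by (rule mult_right_mono[OF ratio])
      moreover have "12 * (real k / real n) * B = 2 * (6 * B * (real k / real n))" by simp
      ultimately show "\<bar>measure_pmf.expectation (random_walk n k) (\<lambda>Z. h (Z i) (Z j))
          - measure_pmf.expectation (random_walk n k) (\<lambda>Z. h (Z i') (Z j'))\<bar> \<le> \<epsilon> * B"
        using random_walk_pair_average[of n i j k h B, OF n0 ij B]
          random_walk_pair_average[of n i' j' k h B, OF n0 ij' B]
        by linarith
    qed
  qed (use set_random_walk[OF n0] in auto)
qed

section \<open>Moving dyadic points by piecewise linear maps\<close>

lemma dyadicI: "of_int a / 2 ^ n \<in> dyadic_rationals"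
  unfolding dyadic_rationals_def by blast

lemma dyadicE:
  assumes "x \<in> dyadic_rationals"
  obtains a n where "x = of_int a / 2 ^ n"
  using assms unfolding dyadic_rationals_def by blast

lemma dyadic_common_denominator:
  assumes "finite X" "X \<subseteq> dyadic_rationals"
  obtains n where "\<And>x. x \<in> X \<Longrightarrow> \<exists>a. x = of_int a / 2 ^ n"
proof -
  have "\<exists>n. \<forall>x\<in>X. \<exists>a. x = of_int a / 2 ^ n"
    using assms
  proof (induction X rule: finite_induct)
    case (insert y X)
    then obtain n where n: "\<forall>x\<in>X. \<exists>a. x = of_int a / 2 ^ n" by auto
    obtain b m where y: "y = of_int b / 2 ^ m" using insert.prems by (auto elim: dyadicE)
    have "\<exists>a. x = of_int a / 2 ^ (n + m)" if x: "x \<in> insert y X" for x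
    proof (cases "x = y")
      case True
      then have "x = of_int (b * 2 ^ n) / 2 ^ (n + m)" by (simp add: y power_add)
      then show ?thesis by blast
    next
      case False
      then obtain a where "x = of_int a / 2 ^ n" using n x by auto
      then have "x = of_int (a * 2 ^ m) / 2 ^ (n + m)" by (simp add: power_add)
      then show ?thesis by blast
    qed
    then show ?case by blast
  qed simp
  then show thesis using that by blast
qed

lemma dyadic_of_int [simp]: "of_int a \<in> dyadic_rationals"
  using dyadicI[of a 0] by simp

lemma dyadic_add:
  assumes "x \<in> dyadic_rationals" "y \<in> dyadic_rationals"
  shows "x + y \<in> dyadic_rationals"
proof -
  obtain n where n: "\<And>z. z \<in> {x, y} \<Longrightarrow> \<exists>a. z = of_int a / 2 ^ n"
    using dyadic_common_denominator[of "{x, y}"] assms by auto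
  then obtain a b where "x = of_int a / 2 ^ n" "y = of_int b / 2 ^ n" by blast
  then have "x + y = of_int (a + b) / 2 ^ n" by (simp add: add_divide_distrib)
  then show ?thesis by (simp only: dyadicI)
qed

lemma dyadic_of_int_mult:
  assumes "x \<in> dyadic_rationals"
  shows "of_int c * x \<in> dyadic_rationals"
proof -
  obtain a n where "x = of_int a / 2 ^ n" using assms by (rule dyadicE)
  then have "of_int c * x = of_int (c * a) / 2 ^ n" by simp
  then show ?thesis by (simp only: dyadicI)
qed

lemma dyadic_half:
  assumes "x \<in> dyadic_rationals"
  shows "x / 2 \<in> dyadic_rationals"
proof -
  obtain a n where "x = of_int a / 2 ^ n" using assms by (rule dyadicE)
  then have "x / 2 = of_int a / 2 ^ Suc n" by simp
  then show ?thesis by (simp only: dyadicI)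
qed

lemma dyadic_diff:
  assumes "x \<in> dyadic_rationals" "y \<in> dyadic_rationals"
  shows "x - y \<in> dyadic_rationals"
  using dyadic_add[OF assms(1) dyadic_of_int_mult[OF assms(2), of "-1"]] by simp

lemma dyadic_double: "x \<in> dyadic_rationals \<Longrightarrow> 2 * x \<in> dyadic_rationals"
  using dyadic_of_int_mult[of x 2] by simp

lemma dyadic_max_min:
  "x \<in> dyadic_rationals \<Longrightarrow> y \<in> dyadic_rationals \<Longrightarrow> max x y \<in> dyadic_rationals"
  "x \<in> dyadic_rationals \<Longrightarrow> y \<in> dyadic_rationals \<Longrightarrow> min x y \<in> dyadic_rationals"
  by (simp_all add: max_def min_def)

lemmas dyadic_intros = dyadic_add dyadic_diff dyadic_half dyadic_double dyadic_max_min

lemma dyadic_between: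
  fixes x y :: real
  assumes "x < y"
  obtains d where "d \<in> dyadic_rationals" "x < d" "d < y"
proof -
  obtain n where n: "1 / 2 ^ n < y - x"
    using real_arch_pow_inv[of "y - x" "1/2"] assms by (auto simp: power_divide)
  define a where "a = \<lfloor>x * 2 ^ n\<rfloor> + 1"
  have "x * 2 ^ n < of_int a" "of_int a \<le> x * 2 ^ n + 1" unfolding a_def by linarith+
  then have "x < of_int a / 2 ^ n" "of_int a / 2 ^ n \<le> x + 1 / 2 ^ n"
    by (simp_all add: field_simps)
  then show thesis using n that[of "of_int a / 2 ^ n"] dyadicI by auto
qed

lemma countable_dyadic: "countable dyadic_rationals"
proof -
  have "dyadic_rationals = (\<lambda>(a, n). of_int a / 2 ^ n) ` (UNIV :: (int \<times> nat) set)"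
    unfolding dyadic_rationals_def by auto
  then show ?thesis by (metis countable_image countableI_type)
qed

text \<open>A rescaled copy of a standard generator of Thompson's group: it has slopes \<open>2\<close>, \<open>1\<close>, \<open>1/2\<close>
  on \<open>[p, p + h]\<close>, \<open>[p + h, p + 2 * h]\<close>, \<open>[p + 2 * h, p + 4 * h]\<close> and is the identity elsewhere.
  It is concave on its support, which gives the formula with \<open>min\<close>. Exchanging \<open>min\<close> and \<open>max\<close> and
  inverting the branches gives the inverse map below.\<close>

definition bump :: "real \<Rightarrow> real \<Rightarrow> real \<Rightarrow> real" where
  "bump p h t = max t (min (2 * t - p) (min (t + h) (t / 2 + p / 2 + 2 * h)))"

definition unbump :: "real \<Rightarrow> real \<Rightarrow> real \<Rightarrow> real" where
  "unbump p h u = min u (max ((u + p) / 2) (max (u - h) (2 * u - p - 4 * h)))"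

lemma unbump_bump:
  assumes "0 < h"
  shows "unbump p h (bump p h t) = t"
proof -
  define u where "u = bump p h t"
  then have "u = max t (min (2 * t - p) (min (t + h) (t / 2 + p / 2 + 2 * h)))"
    by (simp only: bump_def)
  then have "min u (max ((u + p) / 2) (max (u - h) (2 * u - p - 4 * h))) = t"
    using assms by (auto simp: min_def max_def field_simps split: if_splits)
  then show ?thesis by (simp only: unbump_def u_def)
qed

lemma bump_unbump:
  assumes "0 < h"
  shows "bump p h (unbump p h t) = t"
proof -
  define u where "u = unbump p h t"
  then have "u = min t (max ((t + p) / 2) (max (t - h) (2 * t - p - 4 * h)))"
    by (simp only: unbump_def)
  then have "max u (min (2 * u - p) (min (u + h) (u / 2 + p / 2 + 2 * h))) = t"
    using assms by (auto simp: min_def max_def field_simps split: if_splits)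
  then show ?thesis by (simp only: bump_def u_def)
qed

lemma bump_step: "0 < h \<Longrightarrow> bump p h (p + h) = p + 2 * h"
  unfolding bump_def by (simp add: min_def max_def field_simps)

lemma bump_outside: "0 < h \<Longrightarrow> t \<notin> {p<..<p + 4 * h} \<Longrightarrow> bump p h t = t"
  unfolding bump_def by (auto simp: min_def max_def)

lemma strict_mono_bump: "strict_mono (bump p h)"
  unfolding bump_def by (rule strict_monoI) (auto simp: min_def max_def)

lemma interval_avoiding_point:
  fixes I :: "real set"
  assumes "is_interval I" "b \<notin> I"
  shows "(\<forall>x\<in>I. x < b) \<or> (\<forall>x\<in>I. b < x)"
  using assms unfolding is_interval_1 by (metis linorder_neqE order_less_imp_le)

text \<open>On an interval without breakpoints the map coincides with one of its affine branches; dyadic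
  numbers are preserved because both the map and its inverse are built from sums, differences,
  halves, doubles, minima and maxima.\<close>

lemma bump_FR:
  assumes h: "0 < h" and d: "p \<in> dyadic_rationals" "h \<in> dyadic_rationals"
  shows "bump p h \<in> FR_maps"
proof (rule FR_mapsI)
  show "homeomorphism UNIV UNIV (bump p h) (unbump p h)"
    unfolding homeomorphism_def
  proof (intro conjI ballI)
    show "continuous_on UNIV (bump p h)" "continuous_on UNIV (unbump p h)"
      unfolding bump_def[abs_def] unbump_def[abs_def] by (intro continuous_intros; simp)+
    show "range (bump p h) = UNIV" "range (unbump p h) = UNIV"
      using unbump_bump[OF h] bump_unbump[OF h] by (metis surjI)+
  qed (simp_all add: unbump_bump bump_unbump h)
  let ?B = "{p, p + h, p + 2 * h, p + 4 * h}"
  show "finite ?B" by simp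
  have h24: "2 * h \<in> dyadic_rationals" "4 * h \<in> dyadic_rationals"
    using dyadic_of_int_mult[OF d(2), of 2] dyadic_of_int_mult[OF d(2), of 4] by simp_all
  show "?B \<subseteq> dyadic_rationals" using d h24 by (auto intro!: dyadic_add)
  have "bump p h t \<in> dyadic_rationals" "unbump p h t \<in> dyadic_rationals"
    if "t \<in> dyadic_rationals" for t
    unfolding bump_def unbump_def by (intro dyadic_intros d h24 that)+
  then show "bump p h ` dyadic_rationals = dyadic_rationals"
    using bump_unbump[OF h, of p] by (metis image_eqI image_subsetI subsetI subset_antisym)
  fix I :: "real set" assume I: "is_interval I" "I \<inter> ?B = {}"
  then have side: "(\<forall>x\<in>I. x < b) \<or> (\<forall>x\<in>I. b < x)" if "b \<in> ?B" for b
    using interval_avoiding_point[OF I(1), of b] that by blast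
  consider "\<forall>x\<in>I. x < p" | "\<forall>x\<in>I. p < x \<and> x < p + h" | "\<forall>x\<in>I. p + h < x \<and> x < p + 2 * h"
    | "\<forall>x\<in>I. p + 2 * h < x \<and> x < p + 4 * h" | "\<forall>x\<in>I. p + 4 * h < x"
    using side[of p] side[of "p + h"] side[of "p + 2 * h"] side[of "p + 4 * h"] by blast
  then show "\<exists>(k::int) c. \<forall>x\<in>I. bump p h x = 2 powi k * x + c"
  proof cases
    case 1
    then have "\<forall>x\<in>I. bump p h x = 2 powi 0 * x + 0" using h by (auto intro!: bump_outside)
    then show ?thesis by blast
  next
    case 2
    then have "\<forall>x\<in>I. bump p h x = 2 powi 1 * x + (- p)" by (auto simp: bump_def min_def max_def)
    then show ?thesis by blast
  next
    case 3
    then have "\<forall>x\<in>I. bump p h x = 2 powi 0 * x + h" using h by (auto simp: bump_def min_def max_def)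
    then show ?thesis by blast
  next
    case 4
    then have "\<forall>x\<in>I. bump p h x = 2 powi (-1) * x + (p / 2 + 2 * h)"
      using h by (auto simp: bump_def min_def max_def power_int_minus)
    then show ?thesis by blast
  next
    case 5
    then have "\<forall>x\<in>I. bump p h x = 2 powi 0 * x + 0" using h by (auto intro!: bump_outside)
    then show ?thesis by blast
  qed
qed

text \<open>Strict monotonicity is part of the definition because it is what keeps the points of a tuple
  in order while they are moved one by one.\<close>

definition supported_maps :: "real \<Rightarrow> real \<Rightarrow> (real \<Rightarrow> real) set" where
  "supported_maps a b = {g \<in> FR_maps. strict_mono g \<and> (\<forall>t. t \<notin> {a<..<b} \<longrightarrow> g t = t)}"

lemma supported_maps_id: "(\<lambda>x. x) \<in> supported_maps a b"
  by (simp add: supported_maps_def id_FR_maps strict_mono_def)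

lemma supported_maps_compose:
  "f \<in> supported_maps a b \<Longrightarrow> g \<in> supported_maps a b \<Longrightarrow> g \<circ> f \<in> supported_maps a b"
  by (auto simp: supported_maps_def intro: compose_FR_maps strict_mono_o)

lemma supported_maps_mono:
  "a \<le> a' \<Longrightarrow> b' \<le> b \<Longrightarrow> supported_maps a' b' \<subseteq> supported_maps a b"
  by (auto simp: supported_maps_def)

lemma supported_maps_inv:
  assumes "g \<in> supported_maps a b"
  shows "inv_into UNIV g \<in> supported_maps a b"
proof -
  have g: "g \<in> FR_maps" "strict_mono g" "\<And>t. t \<notin> {a<..<b} \<Longrightarrow> g t = t"
    using assms by (auto simp: supported_maps_def)
  have bij: "bij g" by (rule FR_maps_bij[OF g(1)])
  have "strict_mono (inv_into UNIV g)"
  proof (rule strict_monoI)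
    fix x y :: real assume "x < y"
    then show "inv_into UNIV g x < inv_into UNIV g y"
      using strict_mono_less[OF g(2), of "inv_into UNIV g x" "inv_into UNIV g y"] bij
      by (simp add: bij_is_surj surj_f_inv_f)
  qed
  moreover have "inv_into UNIV g t = t" if "t \<notin> {a<..<b}" for t
    using g(3)[OF that] bij by (simp add: inv_f_eq bij_is_inj)
  ultimately show ?thesis using inv_FR_maps[OF g(1)] by (simp add: supported_maps_def)
qed

text \<open>Bumps move \<open>x\<close> to the right in steps of length \<open>h\<close>.\<close>

lemma supported_maps_push_right:
  assumes d: "{a, x, y, b} \<subseteq> dyadic_rationals" and "a < x" "x \<le> y" "y < b"
  shows "\<exists>g\<in>supported_maps a b. g x = y"
proof -
  obtain n where "\<And>z. z \<in> {a, x, y, b} \<Longrightarrow> \<exists>c. z = of_int c / 2 ^ n"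
    using dyadic_common_denominator[OF _ d] by auto
  then have "\<exists>c. a = of_int c / 2 ^ n" "\<exists>c. x = of_int c / 2 ^ n"
      "\<exists>c. y = of_int c / 2 ^ n" "\<exists>c. b = of_int c / 2 ^ n"
    by simp_all
  then obtain ia ix iy ib where i: "a = of_int ia / 2 ^ n" "x = of_int ix / 2 ^ n"
      "y = of_int iy / 2 ^ n" "b = of_int ib / 2 ^ n"
    by (elim exE) (rule that)
  \<comment> \<open>A bump that moves a point from \<open>t\<close> to \<open>t + h\<close> is supported in \<open>[t - h, t + 3 * h]\<close>. Half of a common
    mesh of the four points leaves room for it even in the last step, where \<open>t + h = y\<close>.\<close>
  define h :: real where "h = 1 / 2 ^ Suc n"
  have h: "0 < h" "h \<in> dyadic_rationals" using dyadicI[of 1 "Suc n"] by (auto simp: h_def)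
  have h2: "2 * h = 1 / 2 ^ n" by (simp add: h_def)
  have i': "a = of_int ia * (2 * h)" "x = of_int ix * (2 * h)" "y = of_int iy * (2 * h)"
      "b = of_int ib * (2 * h)"
    unfolding h2 i by simp_all
  have lt: "ia < ix" "ix \<le> iy" "iy < ib" using \<open>a < x\<close> \<open>x \<le> y\<close> \<open>y < b\<close> by (auto simp: i divide_simps)
  have "of_int (ia + 1) * (2 * h) \<le> of_int ix * (2 * h)" "of_int (iy + 1) * (2 * h) \<le> of_int ib * (2 * h)"
    using lt h by (auto intro!: mult_right_mono simp only: of_int_le_iff)
  then have room: "a + h \<le> x" "y + 2 * h \<le> b" using h(1) by (auto simp: i' algebra_simps)
  have "\<exists>g\<in>supported_maps a b. g x = x + real m * h" if "x + real m * h \<le> y" for m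
    using that
  proof (induction m)
    case 0
    show ?case using supported_maps_id[of a b] by (auto intro: bexI[of _ "\<lambda>x. x"])
  next
    case (Suc m)
    have "x + real m * h \<le> y" using Suc.prems h(1) by (simp add: algebra_simps)
    then obtain g where g: "g \<in> supported_maps a b" "g x = x + real m * h" using Suc.IH by blast
    define p where "p = x + real m * h - h"
    have "real m * h \<in> dyadic_rationals" using dyadic_of_int_mult[OF h(2), of "int m"] by simp
    then have p: "p \<in> dyadic_rationals" unfolding p_def using d h by (intro dyadic_intros) auto
    have "0 \<le> real m * h" using h(1) by simp
    then have "a \<le> p" "p + 4 * h \<le> b" using room Suc.prems by (auto simp: p_def algebra_simps)
    then have "bump p h \<in> supported_maps a b"
      using bump_FR[OF h(1) p h(2)] strict_mono_bump bump_outside[OF h(1)] by (auto simp: supported_maps_def)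
    moreover have "bump p h (g x) = x + real (Suc m) * h"
      using bump_step[OF h(1), of p] by (simp add: g p_def algebra_simps)
    ultimately show ?case using supported_maps_compose[OF g(1)] by (metis comp_apply)
  qed
  from this[of "nat (2 * (iy - ix))"] show ?thesis
    using lt by (simp add: i' algebra_simps)
qed

lemma supported_maps_move:
  assumes d: "{a, x, y, b} \<subseteq> dyadic_rationals" and x: "a < x" "x < b" and y: "a < y" "y < b"
  shows "\<exists>g\<in>supported_maps a b. g x = y"
proof (cases "x \<le> y")
  case True
  then show ?thesis using assms by (intro supported_maps_push_right) auto
next
  case False
  then obtain g where g: "g \<in> supported_maps a b" "g y = x"
    using supported_maps_push_right[of a y x b] assms by auto
  have "inj g" using g(1) FR_maps_bij by (auto simp: supported_maps_def bij_is_inj)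
  then have "inv_into UNIV g x = y" using g(2) by (simp add: inv_f_eq)
  then show ?thesis using supported_maps_inv[OF g(1)] by blast
qed

text \<open>The points are placed one by one, from the largest to the smallest. A map \<open>g\<close> that places
  the larger points sends the next point \<open>v\<close> somewhere below all their targets, and a map
  supported below these targets corrects its position without disturbing them.\<close>

theorem supported_maps_transitive:
  assumes "finite V" and d: "a \<in> dyadic_rationals" "b \<in> dyadic_rationals" and "a < b"
    and V: "V \<subseteq> dyadic_rationals \<inter> {a<..<b}"
    and t: "strict_mono_on V t" "t ` V \<subseteq> dyadic_rationals \<inter> {a<..<b}"
  shows "\<exists>g\<in>supported_maps a b. \<forall>v\<in>V. g v = t v"
  using \<open>finite V\<close> V t
proof (induction V rule: finite_linorder_min_induct)
  case empty
  then show ?case using supported_maps_id by blast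
next
  case (insert v V)
  have "V \<subseteq> dyadic_rationals \<inter> {a<..<b}" "strict_mono_on V t" "t ` V \<subseteq> dyadic_rationals \<inter> {a<..<b}"
    using insert.prems monotone_on_subset[OF insert.prems(2)] by auto
  then obtain g where g: "g \<in> supported_maps a b" "\<forall>w\<in>V. g w = t w"
    using insert.IH by blast
  have mono: "strict_mono g" and gFR: "g \<in> FR_maps" and ga: "g a = a" and gb: "g b = b"
    using g(1) by (auto simp: supported_maps_def)
  define c where "c = Min (insert b (t ` V))"
  have c_le: "c \<le> b" "\<And>w. w \<in> V \<Longrightarrow> c \<le> t w" using insert.hyps(1) by (auto simp: c_def)
  have "c \<in> insert b (t ` V)" unfolding c_def using insert.hyps(1) by (intro Min_in) auto
  moreover have "g v < b" "t v < b"
    using strict_monoD[OF mono, of v b] gb insert.prems by auto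
  moreover have "g v < t w" "t v < t w" if "w \<in> V" for w
    using that insert.hyps(2) g(2) strict_monoD[OF mono, of v w] strict_mono_onD[OF insert.prems(2), of v w]
    by auto
  ultimately have c: "c \<in> dyadic_rationals" "g v < c" "t v < c"
    using insert.prems d by auto
  have gv: "a < g v" using strict_mono_less[OF mono, of a v] ga insert.prems by auto
  have "g v \<in> dyadic_rationals" using FR_maps_dyadic[OF gFR] insert.prems by auto
  then obtain s where s: "s \<in> supported_maps a c" "s (g v) = t v"
    using supported_maps_move[of a "g v" "t v" c] c gv insert.prems d by auto
  have "s (t w) = t w" if "w \<in> V" for w
    using s(1) c_le(2)[OF that] by (auto simp: supported_maps_def)
  then have "\<forall>w\<in>insert v V. (s \<circ> g) w = t w" using g s by auto
  moreover have "s \<circ> g \<in> supported_maps a b"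
    using s(1) c_le(1) supported_maps_mono[of a a c b] g(1) by (blast intro: supported_maps_compose)
  ultimately show ?case by blast
qed

section \<open>Countability of the group of dyadic piecewise linear maps\<close>

text \<open>The complement of \<open>B\<close> has finitely many components, and each of them contains two dyadic
  points. A component is described by the set \<open>L\<close> of the points of \<open>B\<close> on its left.\<close>

lemma interval_probes:
  assumes B: "finite B" "B \<subseteq> dyadic_rationals"
  obtains C where "finite C" "B \<subseteq> C" "C \<subseteq> dyadic_rationals"
    "\<And>x. x \<notin> B \<Longrightarrow> \<exists>I d d'. is_interval I \<and> I \<inter> B = {} \<and> x \<in> I \<and>
       d \<in> C \<inter> I \<and> d' \<in> C \<inter> I \<and> d < d'"
proof -
  define R where "R L = (\<Inter>b\<in>L. {b<..}) \<inter> (\<Inter>b\<in>B - L. {..<b})" for L :: "real set"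
  have "\<exists>d d'. L \<subseteq> B \<and> R L \<noteq> {} \<longrightarrow>
      d \<in> dyadic_rationals \<inter> R L \<and> d' \<in> dyadic_rationals \<inter> R L \<and> d < d'" for L
  proof (cases "L \<subseteq> B \<and> R L \<noteq> {}")
    case True
    then obtain x where x: "x \<in> R L" by blast
    have "open (R L)"
      unfolding R_def using True B finite_subset[of L B] by (intro open_Int open_INT) auto
    then obtain e where e: "0 < e" "ball x e \<subseteq> R L" using x open_contains_ball by blast
    obtain d where d: "d \<in> dyadic_rationals" "x < d" "d < x + e"
      using dyadic_between[of x "x + e"] e(1) by auto
    obtain d' where d': "d' \<in> dyadic_rationals" "d < d'" "d' < x + e"
      using dyadic_between[of d "x + e"] d by auto
    have "d \<in> ball x e" "d' \<in> ball x e" using d d' by (auto simp: dist_real_def)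
    then show ?thesis using d d' e by blast
  qed blast
  then obtain D D' where D: "\<And>L. L \<subseteq> B \<Longrightarrow> R L \<noteq> {} \<Longrightarrow>
      D L \<in> dyadic_rationals \<inter> R L \<and> D' L \<in> dyadic_rationals \<inter> R L \<and> D L < D' L"
    by metis
  define C where "C = B \<union> (D ` Pow B \<union> D' ` Pow B) \<inter> dyadic_rationals"
  show thesis
  proof (rule that[of C])
    show "finite C" "B \<subseteq> C" "C \<subseteq> dyadic_rationals" using B by (auto simp: C_def)
    fix x assume "x \<notin> B"
    define L where "L = {b \<in> B. b < x}"
    have x: "x \<in> R L" using \<open>x \<notin> B\<close> by (auto simp: R_def L_def not_less le_less)
    have "L \<subseteq> B" by (auto simp: L_def)
    then have "D L \<in> C \<inter> R L" "D' L \<in> C \<inter> R L" "D L < D' L"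
      using D[of L] x by (auto simp: C_def)
    moreover have "is_interval (R L)"
      unfolding is_interval_1
    proof (intro ballI allI impI)
      fix y z w assume "y \<in> R L" "z \<in> R L" "y \<le> w \<and> w \<le> z"
      then show "w \<in> R L"
        unfolding R_def by (auto intro: less_le_trans[of _ y] le_less_trans[of _ z])
    qed
    moreover have "R L \<inter> B = {}" by (auto simp: R_def)
    ultimately show "\<exists>I d d'. is_interval I \<and> I \<inter> B = {} \<and> x \<in> I \<and>
       d \<in> C \<inter> I \<and> d' \<in> C \<inter> I \<and> d < d'"
      using x by blast
  qed
qed

lemma affine_unique:
  fixes p q c c' d d' :: real
  assumes "p * d + c = q * d + c'" "p * d' + c = q * d' + c'" "d < d'"
  shows "p = q \<and> c = c'"
proof -
  have "(p - q) * (d' - d) = 0" using assms(1,2) by (simp add: algebra_simps)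
  then have "p = q" using assms(3) by simp
  then show ?thesis using assms(1) by simp
qed

text \<open>With the breakpoints in \<open>B\<close>, a map is determined by its finitely many dyadic values on \<open>B\<close>
  and on two further points of each component of the complement, because it is affine there.\<close>

theorem countable_FR_maps: "countable FR_maps"
proof -
  define M where "M B = {f \<in> FR_maps. \<forall>I. is_interval I \<and> I \<inter> B = {} \<longrightarrow>
      (\<exists>(k::int) c. \<forall>x\<in>I. f x = 2 powi k * x + c)}" for B :: "real set"
  have "countable (M B)" if B: "finite B" "B \<subseteq> dyadic_rationals" for B
  proof -
    obtain C where C: "finite C" "B \<subseteq> C" "C \<subseteq> dyadic_rationals"
      and probes: "\<And>x. x \<notin> B \<Longrightarrow> \<exists>I d d'. is_interval I \<and> I \<inter> B = {} \<and> x \<in> I \<and>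
        d \<in> C \<inter> I \<and> d' \<in> C \<inter> I \<and> d < d'"
      by (rule interval_probes[OF B]) (rule that)
    have "inj_on (\<lambda>f. restrict f C) (M B)"
    proof (rule inj_onI, rule ext)
      fix f f' x assume f: "f \<in> M B" "f' \<in> M B" and eq: "restrict f C = restrict f' C"
      have eqC: "f d = f' d" if "d \<in> C" for d using fun_cong[OF eq, of d] that by simp
      show "f x = f' x"
      proof (cases "x \<in> B")
        case True
        then show ?thesis using eqC C(2) by blast
      next
        case False
        then obtain I d d' where I: "is_interval I" "I \<inter> B = {}" "x \<in> I"
          and d: "d \<in> C" "d \<in> I" "d' \<in> C" "d' \<in> I" "d < d'"
          using probes by blast
        obtain k :: int and c where kc: "\<And>y. y \<in> I \<Longrightarrow> f y = 2 powi k * y + c"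
          using f(1) I unfolding M_def by blast
        obtain l :: int and c' where lc: "\<And>y. y \<in> I \<Longrightarrow> f' y = 2 powi l * y + c'"
          using f(2) I unfolding M_def by blast
        have "2 powi k * d + c = 2 powi l * d + c'" "2 powi k * d' + c = 2 powi l * d' + c'"
          using eqC[of d] eqC[of d'] d by (simp_all add: kc lc)
        then have "(2 :: real) powi k = 2 powi l \<and> c = c'" using \<open>d < d'\<close> by (rule affine_unique)
        then show ?thesis using I(3) by (simp add: kc lc)
      qed
    qed
    moreover have "(\<lambda>f. restrict f C) ` M B \<subseteq> (\<Pi>\<^sub>E x\<in>C. dyadic_rationals)"
    proof (intro image_subsetI restrict_PiE_iff[THEN iffD2] ballI)
      fix f d assume "f \<in> M B" "d \<in> C"
      then have "f d \<in> f ` dyadic_rationals" "f \<in> FR_maps" using C(3) by (auto simp: M_def)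
      then show "f d \<in> dyadic_rationals" by (simp add: FR_maps_dyadic)
    qed
    then have "countable ((\<lambda>f. restrict f C) ` M B)"
      by (rule countable_subset) (rule countable_PiE[OF C(1) countable_dyadic])
    ultimately show ?thesis by (rule countable_image_inj_on[rotated])
  qed
  then have "countable (\<Union>B\<in>{B. finite B \<and> B \<subseteq> dyadic_rationals}. M B)"
    by (intro countable_UN[OF countable_Collect_finite_subset[OF countable_dyadic]]) blast
  moreover have "FR_maps \<subseteq> (\<Union>B\<in>{B. finite B \<and> B \<subseteq> dyadic_rationals}. M B)"
  proof
    fix f assume f: "f \<in> FR_maps"
    obtain g B where "homeomorphism UNIV UNIV f g" and B: "finite B" "B \<subseteq> dyadic_rationals"
      and affine: "\<And>I. is_interval I \<Longrightarrow> I \<inter> B = {} \<Longrightarrow> \<exists>(k::int) c. \<forall>x\<in>I. f x = 2 powi k * x + c"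
      using f by (rule FR_mapsE) (rule that)
    have "f \<in> M B" unfolding M_def using f affine by simp
    then show "f \<in> (\<Union>B\<in>{B. finite B \<and> B \<subseteq> dyadic_rationals}. M B)" using B by blast
  qed
  ultimately show ?thesis by (rule countable_subset[rotated])
qed


section \<open>Actions on pairs of dyadic rationals\<close>

lemma nsets_2_ordered:
  fixes x :: "'a::linorder set"
  assumes "x \<in> nsets X 2"
  obtains a b where "a < b" "x = {a, b}" "a \<in> X" "b \<in> X"
proof -
  obtain a b where "x = {a, b}" "a \<noteq> b" "a \<in> X" "b \<in> X"
    using assms by (auto simp: nsets_def card_2_iff)
  then show thesis using that[of a b] that[of b a] by (cases a b rule: linorder_cases) (auto simp: insert_commute)
qed

text \<open>A random increasing sequence \<open>Z\<close> is turned into a random group element which takes the point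
  of rank \<open>r\<close> among the finitely many points involved to \<open>e (Z r)\<close>. An pair is then moved to a
  pair which depends only on two terms of \<open>Z\<close>.\<close>

theorem pairs_equalizable:
  fixes X :: "'a::linorder set" and e :: "nat \<Rightarrow> 'a"
  assumes trans: "\<And>V (\<zeta> :: 'a \<Rightarrow> nat). finite V \<Longrightarrow> V \<subseteq> X \<Longrightarrow> strict_mono_on V \<zeta> \<Longrightarrow>
      \<exists>g\<in>H. \<forall>v\<in>V. g v = e (\<zeta> v)"
    and A: "finite A" "A \<subseteq> nsets X 2" and "0 < \<epsilon>"
  shows "\<exists>\<nu>. finite (set_pmf \<nu>) \<and> set_pmf \<nu> \<subseteq> H \<and>
    equalizes (nsets_action X 2 (eval_action X)) A \<epsilon> \<nu>"
proof -
  define V where "V = \<Union>A"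
  have V: "finite V" "V \<subseteq> X" using A by (auto simp: V_def nsets_def)
  define rank where "rank v = card {u \<in> V. u < v}" for v
  have rank_less: "rank v < rank w" if "v \<in> V" "v < w" for v w
    unfolding rank_def using that V(1) by (intro psubset_card_mono) auto
  have rank_bound: "rank v < card V" if "v \<in> V" for v
    unfolding rank_def using that V(1) by (intro psubset_card_mono) auto
  obtain Q :: "(nat \<Rightarrow> nat) pmf" where Q: "finite (set_pmf Q)" "\<And>Z. Z \<in> set_pmf Q \<Longrightarrow> strict_mono Z"
    and spread: "\<forall>(h :: nat \<Rightarrow> nat \<Rightarrow> real) B i j i' j'. (\<forall>u v. \<bar>h u v\<bar> \<le> B) \<and>
       i < j \<and> j < card V \<and> i' < j' \<and> j' < card V \<longrightarrow>
       \<bar>measure_pmf.expectation Q (\<lambda>Z. h (Z i) (Z j)) - measure_pmf.expectation Q (\<lambda>Z. h (Z i') (Z j'))\<bar> \<le> \<epsilon> * B"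
    by (rule almost_pair_spreadable[OF \<open>0 < \<epsilon>\<close>, where k = "card V"]) (rule that)
  have "\<exists>g. strict_mono Z \<longrightarrow> g \<in> H \<and> (\<forall>v\<in>V. g v = e (Z (rank v)))" for Z :: "nat \<Rightarrow> nat"
  proof (cases "strict_mono Z")
    case True
    then have "strict_mono_on V (Z \<circ> rank)"
      using rank_less by (intro strict_mono_onI) (simp add: strict_mono_less)
    from trans[OF V this] show ?thesis by auto
  qed blast
  then obtain \<gamma> where \<gamma>: "\<And>Z. strict_mono Z \<Longrightarrow> \<gamma> Z \<in> H \<and> (\<forall>v\<in>V. \<gamma> Z v = e (Z (rank v)))"
    by metis
  let ?\<nu> = "map_pmf \<gamma> Q" and ?\<phi> = "nsets_action X 2 (eval_action X)"
  have expect: "measure_pmf.expectation ?\<nu> (\<lambda>g. h (?\<phi> g {a, b})) =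
      measure_pmf.expectation Q (\<lambda>Z. h {e (Z (rank a)), e (Z (rank b))})"
    if "{a, b} \<in> A" for h :: "'a set \<Rightarrow> real" and a b
  proof -
    have ab: "a \<in> V" "b \<in> V" "{a, b} \<in> nsets X 2"
      using Union_upper[OF that] subsetD[OF A(2) that] by (simp_all add: V_def)
    have "?\<phi> (\<gamma> Z) {a, b} = {e (Z (rank a)), e (Z (rank b))}" if "Z \<in> set_pmf Q" for Z
      using \<gamma>[OF Q(2)[OF that]] ab V(2) by (auto simp: nsets_action_def eval_action_def)
    then show ?thesis by (auto intro!: integral_cong_AE simp: AE_measure_pmf_iff)
  qed
  have "equalizes ?\<phi> A \<epsilon> ?\<nu>"
    unfolding equalizes_def
  proof (intro ballI allI impI)
    fix x y and h :: "'a set \<Rightarrow> real" and B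
    assume xy: "x \<in> A" "y \<in> A" and B: "\<forall>z. \<bar>h z\<bar> \<le> B"
    obtain a b where ab: "a < b" "x = {a, b}"
      by (rule nsets_2_ordered[OF subsetD[OF A(2) xy(1)]]) (rule that)
    obtain c d where cd: "c < d" "y = {c, d}"
      by (rule nsets_2_ordered[OF subsetD[OF A(2) xy(2)]]) (rule that)
    have "a \<in> V" "b \<in> V" "c \<in> V" "d \<in> V"
      using Union_upper[OF xy(1)] Union_upper[OF xy(2)] by (simp_all add: V_def ab cd)
    then show "\<bar>measure_pmf.expectation ?\<nu> (\<lambda>g. h (?\<phi> g x)) - measure_pmf.expectation ?\<nu> (\<lambda>g. h (?\<phi> g y))\<bar> \<le> \<epsilon> * B"
      using spread[rule_format, of "\<lambda>u v. h {e u, e v}" B "rank a" "rank b" "rank c" "rank d"]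
        B xy ab cd rank_less rank_bound expect by simp
  qed
  moreover have "finite (set_pmf ?\<nu>)" "set_pmf ?\<nu> \<subseteq> H" using Q \<gamma> by auto
  ultimately show ?thesis by blast
qed

theorem two_liouville_if_transitive_on_increasing_tuples:
  fixes X :: "'a::linorder set" and e :: "nat \<Rightarrow> 'a"
  assumes act: "group_action G X (eval_action X)"
    and X: "countable X" and G: "countable (carrier G)"
    and trans: "\<And>V (\<zeta> :: 'a \<Rightarrow> nat). finite V \<Longrightarrow> V \<subseteq> X \<Longrightarrow> strict_mono_on V \<zeta> \<Longrightarrow>
      \<exists>g\<in>carrier G. \<forall>v\<in>V. g v = e (\<zeta> v)"
  shows "n_liouville 2 G X (eval_action X)"
  unfolding n_liouville_def
proof (rule liouville_criterion)
  interpret act2: group_action G "nsets X 2" "nsets_action X 2 (eval_action X)"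
    using act by (rule group_action.nsets_action)
  show "group G" using act2.group_hom by (simp add: group_hom_def)
  show "nsets_action X 2 (eval_action X) g x \<in> nsets X 2" if "g \<in> carrier G" "x \<in> nsets X 2" for g x
    using act2.element_image[OF that] by simp
  have "nsets X 2 \<subseteq> {A. finite A \<and> A \<subseteq> X}" by (auto simp: nsets_def)
  then show "countable (nsets X 2)"
    by (rule countable_subset) (rule countable_Collect_finite_subset[OF X])
  show "\<exists>\<nu>. finite (set_pmf \<nu>) \<and> set_pmf \<nu> \<subseteq> carrier G \<and>
      equalizes (nsets_action X 2 (eval_action X)) A \<epsilon> \<nu>"
    if "finite A" "A \<subseteq> nsets X 2" "0 < \<epsilon>" for A \<epsilon>
    using trans that by (rule pairs_equalizable)
qed (rule G)

text \<open>The sequence stays inside \<open>(0, 1)\<close>, so that it can serve both groups.\<close>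

definition chain :: "nat \<Rightarrow> real" where
  "chain n = 1 - 1 / 2 ^ Suc n"

lemma chain: "chain n \<in> dyadic_rationals \<inter> {0<..<1}" "m < n \<Longrightarrow> chain m < chain n"
proof -
  have "chain n = of_int (2 ^ Suc n - 1) / 2 ^ Suc n" by (simp add: chain_def field_simps)
  moreover have "(1 :: real) < 2 ^ Suc n" by (rule one_less_power) simp_all
  ultimately show "chain n \<in> dyadic_rationals \<inter> {0<..<1}"
    using dyadicI[of "2 ^ Suc n - 1" "Suc n"] by (simp add: chain_def)
  show "m < n \<Longrightarrow> chain m < chain n"
    unfolding chain_def by (intro diff_strict_left_mono divide_strict_left_mono power_strict_increasing) auto
qed

lemma supported_maps_onto_chain:
  assumes V: "finite V" "V \<subseteq> dyadic_rationals \<inter> {a<..<b}" and \<zeta>: "strict_mono_on V \<zeta>"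
    and ab: "a \<in> dyadic_rationals" "b \<in> dyadic_rationals" "a \<le> 0" "1 \<le> b"
  shows "\<exists>g\<in>supported_maps a b. \<forall>v\<in>V. g v = chain (\<zeta> v)"
proof (rule supported_maps_transitive[OF V(1) ab(1,2) _ V(2)])
  show "strict_mono_on V (\<lambda>v. chain (\<zeta> v))"
    using \<zeta> chain(2) by (auto simp: strict_mono_on_def)
  show "(\<lambda>v. chain (\<zeta> v)) ` V \<subseteq> dyadic_rationals \<inter> {a<..<b}"
  proof (intro image_subsetI)
    show "chain (\<zeta> v) \<in> dyadic_rationals \<inter> {a<..<b}" for v
      using chain(1)[of "\<zeta> v"] ab(3,4) by auto
  qed
qed (use ab in simp)

theorem theorem3:
  shows "n_liouville 2 F (dyadic_rationals \<inter> {0<..<1}) (eval_action (dyadic_rationals \<inter> {0<..<1})) \<and>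
         n_liouville 2 FR dyadic_rationals (eval_action dyadic_rationals)"
proof
  have d01: "0 \<in> dyadic_rationals" "1 \<in> dyadic_rationals"
    using dyadic_of_int[of 0] dyadic_of_int[of 1] by simp_all
  show "n_liouville 2 F (dyadic_rationals \<inter> {0<..<1}) (eval_action (dyadic_rationals \<inter> {0<..<1}))"
  proof (rule two_liouville_if_transitive_on_increasing_tuples[OF F_group_action])
    show "countable (dyadic_rationals \<inter> {0<..<1})" using countable_dyadic by blast
    have "carrier F \<subseteq> FR_maps" by (auto simp: F_def F_maps_def)
    then show "countable (carrier F)" using countable_FR_maps by (rule countable_subset)
    have "supported_maps 0 1 \<subseteq> carrier F"
      by (auto simp: supported_maps_def F_def F_maps_def)
    then show "\<exists>g\<in>carrier F. \<forall>v\<in>V. g v = chain (\<zeta> v)"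
      if "finite V" "V \<subseteq> dyadic_rationals \<inter> {0<..<1}" "strict_mono_on V \<zeta>" for V and \<zeta> :: "real \<Rightarrow> nat"
      using supported_maps_onto_chain[OF that d01] by auto
  qed
  show "n_liouville 2 FR dyadic_rationals (eval_action dyadic_rationals)"
  proof (rule two_liouville_if_transitive_on_increasing_tuples[OF FR_group_action countable_dyadic])
    show "countable (carrier FR)" using countable_FR_maps by (simp add: FR_def)
    show "\<exists>g\<in>carrier FR. \<forall>v\<in>V. g v = chain (\<zeta> v)"
      if V: "finite V" "V \<subseteq> dyadic_rationals" "strict_mono_on V \<zeta>" for V and \<zeta> :: "real \<Rightarrow> nat"
    proof -
      \<comment> \<open>Finitely many dyadic points and the chain lie in a bounded interval with dyadic ends, and a map
        supported there suffices.\<close>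
      define a b where "a = Min (insert 0 V) - 1" and "b = Max (insert 1 V) + 1"
      have "Min (insert 0 V) \<in> insert 0 V" "Max (insert 1 V) \<in> insert 1 V"
        using V(1) by (intro Min_in Max_in; simp)+
      then have "a \<in> dyadic_rationals" "b \<in> dyadic_rationals"
        unfolding a_def b_def using V(2) d01 by (auto intro!: dyadic_diff dyadic_add)
      moreover have "Min (insert 0 V) \<le> v \<and> v \<le> Max (insert 1 V)" if "v \<in> V" for v
        using V(1) that by simp
      then have "V \<subseteq> dyadic_rationals \<inter> {a<..<b}" using V(2) by (force simp: a_def b_def)
      moreover have "Min (insert 0 V) \<le> 0" "1 \<le> Max (insert 1 V)"
        using V(1) by (auto intro!: Min_le Max_ge)
      then have "a \<le> 0" "1 \<le> b" by (simp_all add: a_def b_def)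
      ultimately obtain g where "g \<in> supported_maps a b" "\<forall>v\<in>V. g v = chain (\<zeta> v)"
        using supported_maps_onto_chain[OF V(1) _ V(3)] by blast
      then show ?thesis by (auto simp: supported_maps_def FR_def)
    qed
  qed
qed

end
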